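(* There exists an absolute constant $C$ such that for every integer $n \geq 2$, $$H(n) \leq \frac{C n^{1/2}}{\log n},$$ where $H(n)$ denotes the maximum of $\chi(G)/\sigma(G)$ over all $n$-vertex graphs $G$.
   Context: Graphs are finite and simple, and $\log$ denotes the natural logarithm. $\chi(G)$ is the chromatic number of $G$. A subdivision of a graph $H$ is any graph formed by replacing edges of $H$ by internally vertex-disjoint paths (a path may be a single edge). $\sigma(G)$ denotes the largest integer $p$ such that $G$ contains (as a subgraph) a subdivision of the complete graph $K_p$ of order $p$. *)

theory Defs
  imports Complex_Main "Graph_Theory.Graph_Theory"
begin

text \<open>
  A finite simple graph is a \<^locale>\<open>pair_graph\<close>: a finite, symmetric, loop-free set of
  ordered pairs on a finite vertex set, an edge being represented by both of its orientations.
\<close>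

definition colourable :: "'a pair_pre_digraph \<Rightarrow> nat \<Rightarrow> bool" where
  "colourable G k \<longleftrightarrow>
     (\<exists>c. (\<forall>v \<in> pverts G. c v < k) \<and> (\<forall>(u, v) \<in> parcs G. c u \<noteq> c v))"

definition chromatic_number :: "'a pair_pre_digraph \<Rightarrow> nat" where
  "chromatic_number G = (LEAST k. colourable G k)"

text \<open>
  The library generates the subdivisions of a graph by repeatedly replacing an edge by a path of
  length two through a fresh vertex.  The branch vertices of the subdivision \<open>S\<close> are the vertices
  of \<open>K\<close>, so that \<open>K\<close> can be taken over the same vertex type.
\<close>

definition contains_complete_subdivision :: "'a pair_pre_digraph \<Rightarrow> nat \<Rightarrow> bool" where
  "contains_complete_subdivision G p \<longleftrightarrow>
     (\<exists>K S :: 'a pair_pre_digraph.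
        complete_digraph p (with_proj K) \<and> subdivision_pair K S \<and>
        subgraph (with_proj S) (with_proj G))"

definition subdivision_number :: "'a pair_pre_digraph \<Rightarrow> nat" where
  "subdivision_number G = Max {p. contains_complete_subdivision G p}"

text \<open>
  Up to isomorphism every finite graph has its vertices in \<^typ>\<open>nat\<close>; fixing this type makes
  \<open>hajos_H n\<close> a single number.
\<close>

definition chi_sigma_ratios :: "nat \<Rightarrow> real set" where
  "chi_sigma_ratios n =
     {real (chromatic_number G) / real (subdivision_number G) | G :: nat pair_pre_digraph.
        pair_graph G \<and> card (pverts G) = n}"

definition hajos_H :: "nat \<Rightarrow> real" where
  "hajos_H n = Max (chi_sigma_ratios n)"


subsection \<open>The minimum and the maxima above are attained\<close>

lemma colourable_card:
  assumes "pair_graph G"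
  shows "colourable G (card (pverts G))"
proof -
  interpret pair_graph G by fact
  obtain c where c: "bij_betw c (pverts G) {0..<card (pverts G)}"
    using ex_bij_betw_finite_nat pair_finite_verts by blast
  have "c u \<noteq> c v" if "(u, v) \<in> parcs G" for u v
    using that c pair_no_loops[OF that] in_arcsD1[OF that] in_arcsD2[OF that]
    by (auto simp: bij_betw_def inj_on_def)
  then show ?thesis
    using c unfolding colourable_def by (intro exI[of _ c]) (auto simp: bij_betw_def)
qed

lemma colourable_chromatic_number:
  assumes "pair_graph G"
  shows "colourable G (chromatic_number G)"
  unfolding chromatic_number_def using colourable_card[OF assms] by (rule LeastI)

lemma chromatic_number_le_card:
  assumes "pair_graph G"
  shows "chromatic_number G \<le> card (pverts G)"
  unfolding chromatic_number_def using colourable_card[OF assms] by (rule Least_le)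

lemma pverts_subdivision: "subdivision_pair K S \<Longrightarrow> pverts K \<subseteq> pverts S"
proof (induct rule: subdivision_pair_induct)
  case (divide e w S)
  then show ?case by (cases e) (auto simp: subdivide.simps)
qed simp

lemma contains_complete_subdivision_le_card:
  assumes "pair_graph G" "contains_complete_subdivision G p"
  shows "p \<le> card (pverts G)"
proof -
  interpret pair_graph G by fact
  obtain K S :: "'a pair_pre_digraph" where
    "complete_digraph p (with_proj K)" "subdivision_pair K S"
    "subgraph (with_proj S) (with_proj G)"
    using assms(2) unfolding contains_complete_subdivision_def by blast
  then have "card (pverts K) = p" "pverts K \<subseteq> pverts G"
    using pverts_subdivision[of K S] by (auto simp: complete_digraph_def subgraph_def)
  then show ?thesis using card_mono[OF pair_finite_verts] by blast
qed

lemma contains_complete_subdivision_trivial: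
  assumes "pair_graph G" "A \<subseteq> pverts G" "card A \<le> 1"
  shows "contains_complete_subdivision G (card A)"
proof -
  interpret pair_graph G by fact
  define K where "K = \<lparr>pverts = A, parcs = {}\<rparr>"
  have fin: "finite A" using assms(2) pair_finite_verts finite_subset by blast
  have eq: "u = v" if "u \<in> A" "v \<in> A" for u v
    using that assms(3) fin by (metis card_le_Suc0_iff_eq One_nat_def)
  have K: "complete_digraph (card A) (with_proj K)"
    using fin eq unfolding complete_digraph_pair_def by (auto simp: K_def)
  then interpret K: pair_graph K by (rule pair_graphI_complete)
  have "subdivision_pair K K"
    by (rule subdivision_pair_base) unfold_locales
  moreover have "subgraph (with_proj K) (with_proj G)"
    using assms(2) K.wf_digraph wf_digraph
    by (auto simp: subgraph_def K_def compatibleI_with_proj)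
  ultimately show ?thesis
    using K unfolding contains_complete_subdivision_def by blast
qed

lemma finite_contains_complete_subdivision:
  assumes "pair_graph G"
  shows "finite {p. contains_complete_subdivision G p}"
  by (rule finite_subset[of _ "{..card (pverts G)}"])
     (auto intro: contains_complete_subdivision_le_card[OF assms])

lemma contains_subdivision_number:
  assumes "pair_graph G"
  shows "contains_complete_subdivision G (subdivision_number G)"
  using Max_in[OF finite_contains_complete_subdivision[OF assms]]
    contains_complete_subdivision_trivial[OF assms, of "{}"]
  unfolding subdivision_number_def by auto

lemma subdivision_number_pos:
  assumes "pair_graph G" "pverts G \<noteq> {}"
  shows "1 \<le> subdivision_number G"
proof -
  obtain v where "v \<in> pverts G" using assms(2) by blast
  then have "contains_complete_subdivision G 1"
    using contains_complete_subdivision_trivial[OF assms(1), of "{v}"] by simp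
  then show ?thesis
    unfolding subdivision_number_def
    by (intro Max_ge finite_contains_complete_subdivision[OF assms(1)]) simp
qed

lemma finite_chi_sigma_ratios: "finite (chi_sigma_ratios n)"
proof (rule finite_subset)
  show "chi_sigma_ratios n \<subseteq> (\<lambda>(a, b). real a / real b) ` ({..n} \<times> {..n})"
    using chromatic_number_le_card
      contains_complete_subdivision_le_card[OF _ contains_subdivision_number]
    unfolding chi_sigma_ratios_def by fastforce
qed simp

lemma chi_sigma_ratios_nonempty: "chi_sigma_ratios n \<noteq> {}"
proof -
  define G :: "nat pair_pre_digraph" where "G = \<lparr>pverts = {..<n}, parcs = {}\<rparr>"
  have "pair_graph G"
    by unfold_locales (auto simp: G_def symmetric_def sym_def)
  moreover have "card (pverts G) = n" by (simp add: G_def)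
  ultimately show ?thesis unfolding chi_sigma_ratios_def by blast
qed

end

theory Submission
  imports Defs
begin

text \<open>
  Write \<open>\<alpha>(A)\<close> for the independence number of the subgraph induced by a vertex set \<open>A\<close>.  The proof
  compares both \<open>\<chi>\<close> and \<open>\<sigma>\<close> with one number.  Among the nonempty vertex sets of \<open>G\<close> choose a set \<open>U\<close>
  that minimises \<open>\<alpha>(U) / |U| powr (2/3)\<close>, and let \<open>\<kappa>\<close> be the minimum.  Every vertex set \<open>A\<close> then
  contains an independent set of size \<open>\<kappa> |A| powr (2/3)\<close>, and greedy colouring with such sets gives
  \<open>\<chi>(G) \<le> 3 n powr (1/3) / \<kappa>\<close>.  On the other side \<open>\<sigma>(G) \<ge> c sqrt m ln m / \<alpha>(U)\<close> for \<open>m = |U|\<close>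
  (\<open>large_linked_set\<close>); the quotient of the two bounds is at most
  \<open>C n powr (1/3) m powr (1/6) / ln m\<close>, which for \<open>m \<le> n\<close> is at most \<open>C sqrt n / ln n\<close>.  The
  exponent \<open>2/3\<close> is one choice between \<open>1/2\<close> and \<open>1\<close>: since it exceeds \<open>1/2\<close>, the last expression grows
  with \<open>m\<close>, and since it is below \<open>1\<close>, the graph on \<open>U\<close> expands.

  The lower bound on \<open>\<sigma>\<close> is a statement about the graph on \<open>V = U\<close>, with \<open>n = |V|\<close>,
  \<open>L = ln n\<close> and \<open>\<alpha> = \<alpha>(V)\<close>.

  \<^item> Expansion.  Two sets without edges between them have additive independence numbers, while no
    subset of \<open>V\<close> has a much smaller independence number than its size warrants.  So the vertices
    outside \<open>S \<union> N(S)\<close> cannot be many when \<open>\<alpha>(S)\<close> is large, and \<open>\<alpha>(S)\<close> grows by a constant factor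
    when \<open>S\<close> is enlarged by its neighbourhood, even after the deletion of up to \<open>n \<alpha>(S) / (4\<alpha>)\<close>
    vertices.  Hence two sets with independence number at least \<open>t\<close> are joined by a path whose length
    is logarithmic in \<open>\<alpha> / t\<close>, and which avoids any given set of \<open>n t / (4\<alpha>)\<close> vertices
    (\<open>connecting_path\<close>).

  \<^item> Routing.  Given a set \<open>P\<close> of prospective branch vertices, join as many nonadjacent pairs of \<open>P\<close>
    as possible by short disjoint paths.  A pair stays unjoined only when the used vertices
    leave fewer than \<open>n / (4\<alpha>)\<close> neighbours to one of its ends.  If \<open>P\<close> is a union of independent sets
    of size \<open>t\<close> and this happened to half of \<open>P\<close>, it would happen to half of one of these independent
    sets; but the closed neighbourhood of an independent set has at least \<open>n / \<alpha>\<close> elements per element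
    of the set, more than the paths can have used.  So half of \<open>P\<close> survives (\<open>routing_to_most_of_block_union\<close>).

  \<^item> Scale.  The paths fit into \<open>V\<close> when the number of nonadjacent pairs times the path length is at
    most a small multiple of \<open>n t / \<alpha>\<close>.  For \<open>|P|\<close> about \<open>sqrt n L / \<alpha>\<close> this needs \<open>P\<close> to have at most
    a fraction \<open>q\<close> of its pairs nonadjacent, where \<open>q L\<^sup>2 \<le> C t\<^sup>2\<close>.  If every set of size \<open>n / (4\<alpha>)\<close> has
    independence number at least \<open>L / 4\<close>, then \<open>q = 1\<close> is good enough and \<open>P\<close> may lie anywhere.
    Otherwise take a set \<open>W\<close> whose independence number \<open>j\<close> is least among the sets of size at
    least \<open>n exp(- \<eta>(j))\<close>, where \<open>\<eta>(j)\<close> grows slowly as \<open>j\<close> decreases.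
    The non-neighbours in \<open>W\<close> of a vertex have independence number
    below \<open>j\<close>, so they are few, and choosing \<open>P\<close> inside \<open>W\<close> gives \<open>q = exp(- c sqrt(L / j))\<close> with \<open>t\<close>
    about \<open>j / 4\<close>.  The smaller \<open>t\<close> is, the denser is \<open>W\<close> (\<open>dense_part\<close>).
\<close>


section \<open>Complete subdivisions from linked vertex sets\<close>

text \<open>
  Subdividing the edge \<open>(x, y)\<close> at the first vertex \<open>w\<close> of the path leaves an edge \<open>(w, y)\<close> to be replaced
  by the rest of the path.  All edges of the path belong to \<open>A\<close>, which is the edge set of the host
  graph in the application.
\<close>

lemma subdivision_pair_replace_edge_by_path:
  assumes "subdivision_pair K H" "(x, y) \<in> parcs H" "ws \<noteq> []" "distinct ws"
    and "set ws \<inter> pverts H = {}" "sym A" "successively (\<lambda>a b. (a, b) \<in> A) (x # ws @ [y])"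
  shows "\<exists>S. subdivision_pair K S \<and> pverts S = pverts H \<union> set ws \<and>
    parcs S \<subseteq> (parcs H - {(x, y), (y, x)}) \<union> A \<and> parcs H - {(x, y), (y, x)} \<subseteq> parcs S"
  using assms
proof (induction ws arbitrary: H x)
  case (Cons w ws)
  interpret H: pair_bidirected_digraph H
    using Cons.prems(1) by (rule bidirected_digraphI_subdivision)
  define H' where "H' = subdivide H (x, y) w"
  have sub: "subdivision_pair K H'"
    unfolding H'_def using Cons.prems by (intro subdivision_pair_divide) auto
  have parcs': "parcs H' = (parcs H - {(x, y), (y, x)}) \<union> {(x, w), (w, x), (w, y), (y, w)}"
    unfolding H'_def by auto
  have xw: "(x, w) \<in> A" "(w, x) \<in> A"
    using Cons.prems(6,7) by (auto dest: symD)
  have fresh: "(w, y) \<notin> parcs H" "(y, w) \<notin> parcs H"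
    using Cons.prems(5) by (auto dest: H.in_arcsD1 H.in_arcsD2)
  show ?case
  proof (cases "ws = []")
    case True
    then have "(w, y) \<in> A" "(y, w) \<in> A"
      using Cons.prems(6,7) by (auto dest: symD)
    then show ?thesis
      using True sub xw unfolding parcs' by (intro exI[of _ H']) (auto simp: H'_def)
  next
    case False
    obtain S where S: "subdivision_pair K S" "pverts S = pverts H' \<union> set ws"
      "parcs S \<subseteq> (parcs H' - {(w, y), (y, w)}) \<union> A" "parcs H' - {(w, y), (y, w)} \<subseteq> parcs S"
      using Cons.IH[OF sub, of w] Cons.prems False by (auto simp: H'_def)
    have "parcs S \<subseteq> (parcs H - {(x, y), (y, x)}) \<union> A"
      using S(3) xw unfolding parcs' by auto
    moreover have "parcs H - {(x, y), (y, x)} \<subseteq> parcs S"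
      using S(4) fresh unfolding parcs' by auto
    ultimately show ?thesis
      using S(1,2) by (auto simp: H'_def)
  qed
qed simp

definition links :: "('a \<Rightarrow> 'a \<Rightarrow> bool) \<Rightarrow> 'a \<Rightarrow> 'a list \<Rightarrow> 'a \<Rightarrow> bool" where
  "links E x ws y \<longleftrightarrow> ws \<noteq> [] \<and> distinct ws \<and> successively E (x # ws @ [y])"

text \<open>
  The complete graph on \<open>Q\<close> is turned into a subgraph of \<open>G\<close> by replacing its edges outside \<open>G\<close> one at
  a time.  After the pairs in \<open>D\<close> have been treated, the only edges outside \<open>G\<close> are the pairs of
  \<open>M - D\<close>; the linear order serves to list every unordered pair once.
\<close>

lemma contains_complete_subdivision_if_links:
  fixes G :: "('a :: linorder) pair_pre_digraph"
  defines "E \<equiv> \<lambda>x y. (x, y) \<in> parcs G"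
  assumes G: "pair_graph G" and Q: "Q \<subseteq> pverts G"
    and M: "M = {(x, y). x \<in> Q \<and> y \<in> Q \<and> x < y \<and> \<not> E x y}"
    and \<rho>: "\<And>x y. (x, y) \<in> M \<Longrightarrow> links E x (\<rho> (x, y)) y \<and> set (\<rho> (x, y)) \<subseteq> pverts G - Q"
    and disj: "\<And>e f. e \<in> M \<Longrightarrow> f \<in> M \<Longrightarrow> e \<noteq> f \<Longrightarrow> set (\<rho> e) \<inter> set (\<rho> f) = {}"
  shows "contains_complete_subdivision G (card Q)"
proof -
  interpret G: pair_graph G by fact
  have finQ: "finite Q" using Q G.pair_finite_verts finite_subset by blast
  have finM: "finite M"
    by (rule finite_subset[of _ "Q \<times> Q"]) (use finQ M in auto)
  define K where "K = \<lparr>pverts = Q, parcs = {(u, v). u \<in> Q \<and> v \<in> Q \<and> u \<noteq> v}\<rparr>"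
  have K: "complete_digraph (card Q) (with_proj K)"
    using finQ unfolding complete_digraph_pair_def by (auto simp: K_def)
  then interpret K: pair_graph K by (rule pair_graphI_complete)
  have symG: "sym (parcs G)" by (auto intro: symI G.arcs_symmetric)
  have stage: "\<exists>S. subdivision_pair K S \<and> pverts S = Q \<union> (\<Union>e\<in>D. set (\<rho> e)) \<and>
      parcs S \<subseteq> parcs G \<union> (M - D) \<union> (M - D)\<inverse> \<and> M - D \<subseteq> parcs S" if "D \<subseteq> M" for D
    using finite_subset[OF that finM] that
  proof (induction D rule: finite_induct)
    case empty
    have "subdivision_pair K K" by (rule subdivision_pair_base) unfold_locales
    moreover have "parcs K \<subseteq> parcs G \<union> M \<union> M\<inverse>"
      using G.arcs_symmetric by (auto simp: K_def M E_def)
    ultimately show ?case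
      by (intro exI[of _ K]) (auto simp: K_def M)
  next
    case (insert e D)
    obtain x y where e: "e = (x, y)" by (cases e)
    obtain S where S: "subdivision_pair K S" "pverts S = Q \<union> (\<Union>e\<in>D. set (\<rho> e))"
      "parcs S \<subseteq> parcs G \<union> (M - D) \<union> (M - D)\<inverse>" "M - D \<subseteq> parcs S"
      using insert by blast
    have eM: "(x, y) \<in> M" using insert.prems e by auto
    have ends: "x \<in> Q" "y \<in> Q" "x < y" "(x, y) \<notin> parcs G" using eM M by (auto simp: E_def)
    have "set (\<rho> e) \<inter> set (\<rho> f) = {}" if "f \<in> D" for f
      using disj[of e f] insert that by auto
    then have fresh: "set (\<rho> e) \<inter> pverts S = {}"
      using \<rho>[OF eM] S(2) e by auto
    have "\<exists>S'. subdivision_pair K S' \<and> pverts S' = pverts S \<union> set (\<rho> e) \<and>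
        parcs S' \<subseteq> (parcs S - {(x, y), (y, x)}) \<union> parcs G \<and>
        parcs S - {(x, y), (y, x)} \<subseteq> parcs S'"
      using \<rho>[OF eM] S eM insert.hyps e fresh symG
      by (intro subdivision_pair_replace_edge_by_path) (auto simp: links_def E_def)
    then obtain S' where S': "subdivision_pair K S'" "pverts S' = pverts S \<union> set (\<rho> e)"
      "parcs S' \<subseteq> (parcs S - {(x, y), (y, x)}) \<union> parcs G"
      "parcs S - {(x, y), (y, x)} \<subseteq> parcs S'" by blast
    have "parcs S' \<subseteq> parcs G \<union> (M - insert e D) \<union> (M - insert e D)\<inverse>"
      using S'(3) S(3) e by auto
    moreover have "(y, x) \<notin> M" using M ends by auto
    then have "M - insert e D \<subseteq> parcs S'" using S'(4) S(4) e by auto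
    ultimately show ?case
      using S' S(2) by (intro exI[of _ S']) auto
  qed
  obtain S where S: "subdivision_pair K S" "pverts S = Q \<union> (\<Union>e\<in>M. set (\<rho> e))"
    "parcs S \<subseteq> parcs G" using stage[of M] by auto
  interpret S: pair_bidirected_digraph S
    using S(1) by (rule bidirected_digraphI_subdivision)
  have "pverts S \<subseteq> pverts G" using S(2) Q \<rho> by force
  then have "subgraph (with_proj S) (with_proj G)"
    using S(3) S.wf_digraph G.wf_digraph by (auto simp: subgraph_def compatibleI_with_proj)
  then show ?thesis
    using K S(1) unfolding contains_complete_subdivision_def by blast
qed


section \<open>Independence numbers of vertex sets\<close>

text \<open>
  The edge relation is not confined to \<open>V\<close>, so that the graph induced on a subset of \<open>V\<close> is an instance
  with the same relation.
\<close>

locale finite_graph =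
  fixes V :: "('a :: linorder) set" and E :: "'a \<Rightarrow> 'a \<Rightarrow> bool"
  assumes finite_V: "finite V"
    and sym: "E x y \<Longrightarrow> E y x"
    and irrefl: "\<not> E x x"
begin

definition indep :: "'a set \<Rightarrow> bool" where
  "indep I \<longleftrightarrow> (\<forall>x\<in>I. \<forall>y\<in>I. \<not> E x y)"

definition \<alpha> :: "'a set \<Rightarrow> nat" where
  "\<alpha> A = Max (card ` {I. I \<subseteq> A \<and> indep I})"

definition nbhd :: "'a set \<Rightarrow> 'a set" where
  "nbhd S = {v \<in> V. \<exists>u\<in>S. E u v}"

lemma finite_subset_V: "A \<subseteq> V \<Longrightarrow> finite A"
  using finite_V finite_subset by blast

lemma indep_subset: "indep I \<Longrightarrow> J \<subseteq> I \<Longrightarrow> indep J"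
  unfolding indep_def by blast

lemma indep_card_le_\<alpha>:
  assumes "A \<subseteq> V" "I \<subseteq> A" "indep I"
  shows "card I \<le> \<alpha> A"
  unfolding \<alpha>_def using assms finite_subset_V[OF assms(1)] by (intro Max_ge) auto

lemma \<alpha>_attained:
  assumes "A \<subseteq> V"
  obtains I where "I \<subseteq> A" "indep I" "card I = \<alpha> A"
proof -
  have "{} \<in> {I. I \<subseteq> A \<and> indep I}" by (simp add: indep_def)
  then have "\<alpha> A \<in> card ` {I. I \<subseteq> A \<and> indep I}"
    unfolding \<alpha>_def using finite_subset_V[OF assms] by (intro Max_in) auto
  then show ?thesis using that by auto
qed

lemma indep_of_card:
  assumes "A \<subseteq> V" "k \<le> \<alpha> A"
  obtains I where "I \<subseteq> A" "indep I" "card I = k"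
proof -
  obtain J where J: "J \<subseteq> A" "indep J" "card J = \<alpha> A" using \<alpha>_attained[OF assms(1)] .
  then obtain I where "I \<subseteq> J" "card I = k"
    using assms(2) obtain_subset_with_card_n[of k J] by auto
  then show ?thesis using J indep_subset that by blast
qed

lemma \<alpha>_mono: "A \<subseteq> B \<Longrightarrow> B \<subseteq> V \<Longrightarrow> \<alpha> A \<le> \<alpha> B"
  using \<alpha>_attained[of A] indep_card_le_\<alpha>[of B] by (metis order_trans)

lemma \<alpha>_le_card: "A \<subseteq> V \<Longrightarrow> \<alpha> A \<le> card A"
  using \<alpha>_attained[of A] by (metis card_mono finite_subset_V)

lemma \<alpha>_pos:
  assumes "A \<subseteq> V" "A \<noteq> {}"
  shows "1 \<le> \<alpha> A"
proof -
  obtain x where "x \<in> A" using assms by blast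
  then show ?thesis
    using indep_card_le_\<alpha>[OF assms(1), of "{x}"] irrefl by (simp add: indep_def)
qed

lemma nbhd_subset: "nbhd S \<subseteq> V"
  by (auto simp: nbhd_def)

lemma \<alpha>_additive:
  assumes "S \<subseteq> V" "T \<subseteq> V" "S \<inter> T = {}" "T \<inter> nbhd S = {}"
  shows "\<alpha> S + \<alpha> T \<le> \<alpha> (S \<union> T)"
proof -
  obtain I J where I: "I \<subseteq> S" "indep I" "card I = \<alpha> S" and J: "J \<subseteq> T" "indep J" "card J = \<alpha> T"
    using \<alpha>_attained assms(1,2) by metis
  have "\<not> E x y" if "x \<in> I" "y \<in> J" for x y
    using that I(1) J(1) assms unfolding nbhd_def by blast
  then have "indep (I \<union> J)" using I(2) J(2) sym unfolding indep_def by blast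
  moreover have "card (I \<union> J) = \<alpha> S + \<alpha> T"
    using I J assms finite_subset_V by (subst card_Un_disjoint) (auto intro: finite_subset)
  ultimately show ?thesis
    using indep_card_le_\<alpha>[of "S \<union> T" "I \<union> J"] I(1) J(1) assms by auto
qed

text \<open>A shortest walk is a path.\<close>

lemma walk_imp_path:
  assumes "xs \<noteq> []" "hd xs \<in> A" "last xs \<in> B" "successively E xs" "set xs \<subseteq> R" "length xs \<le> k"
  obtains ys where "ys \<noteq> []" "hd ys \<in> A" "last ys \<in> B" "successively E ys" "set ys \<subseteq> R"
    "length ys \<le> k" "distinct ys"
proof -
  define W where "W = (\<lambda>xs. xs \<noteq> [] \<and> hd xs \<in> A \<and> last xs \<in> B \<and> successively E xs \<and> set xs \<subseteq> R)"
  have "W xs" using assms unfolding W_def by simp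
  then obtain ys where ys: "W ys" "\<And>zs. W zs \<Longrightarrow> length ys \<le> length zs"
    using arg_min_nat_lemma[of W xs length] by blast
  have "distinct ys"
  proof (rule ccontr)
    assume "\<not> distinct ys"
    then obtain as bs cs y where dec: "ys = as @ [y] @ bs @ [y] @ cs"
      using not_distinct_decomp by blast
    have "W (as @ [y] @ cs)"
      using ys(1) unfolding W_def dec
      by (cases as; cases cs) (auto simp: successively_append_iff successively_Cons hd_append split: if_splits)
    then show False using ys(2) dec by fastforce
  qed
  moreover have "length ys \<le> k" using ys(2)[OF \<open>W xs\<close>] assms(6) by linarith
  ultimately show ?thesis using that ys(1) unfolding W_def by blast
qed

text \<open>
  Removing an independent set of size at least \<open>\<kappa> y\<^sup>2\<close> from a set of size \<open>y\<^sup>3\<close> reduces the cube root of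
  the size by at least \<open>\<kappa> / 3\<close>.
\<close>

lemma greedy_colouring:
  assumes \<kappa>: "0 < \<kappa>"
    and large: "\<And>A. A \<subseteq> V \<Longrightarrow> \<kappa> * root 3 (card A) ^ 2 \<le> \<alpha> A"
    and "A \<subseteq> V"
  shows "\<exists>c k. (\<forall>v\<in>A. c v < k) \<and> (\<forall>u\<in>A. \<forall>v\<in>A. E u v \<longrightarrow> c u \<noteq> c v) \<and>
    real k \<le> 3 * root 3 (card A) / \<kappa>"
  using finite_subset_V[OF assms(3)] assms(3)
proof (induction A rule: finite_psubset_induct)
  case (psubset A)
  show ?case
  proof (cases "A = {}")
    case True
    then show ?thesis by (intro exI[of _ "\<lambda>_. 0"] exI[of _ 0]) simp
  next
    case False
    obtain I where I: "I \<subseteq> A" "indep I" "card I = \<alpha> A" using \<alpha>_attained[OF psubset.prems] .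
    have "I \<noteq> {}" using I(3) \<alpha>_pos[OF psubset.prems False] by auto
    then have "A - I \<subset> A" using I(1) by auto
    have "A - I \<subseteq> V" using psubset.prems by blast
    from psubset.IH[OF \<open>A - I \<subset> A\<close> this] obtain c k where IH: "(\<forall>v\<in>A - I. c v < k) \<and>
        (\<forall>u\<in>A - I. \<forall>v\<in>A - I. E u v \<longrightarrow> c u \<noteq> c v) \<and>
        real k \<le> 3 * root 3 (card (A - I)) / \<kappa>"
      by (elim exE) (rule that)
    note c = IH[THEN conjunct1] IH[THEN conjunct2, THEN conjunct1]
      and k = IH[THEN conjunct2, THEN conjunct2]
    define y where "y = root 3 (card A)"
    define z where "z = root 3 (card (A - I))"
    have y: "y ^ 3 = card A" "0 < y" using False psubset.hyps
      by (auto simp: y_def card_gt_0_iff)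
    have z: "z ^ 3 = card (A - I)" "0 \<le> z" by (auto simp: z_def)
    have zy: "z \<le> y" unfolding y_def z_def
      using psubset.hyps by (auto intro: card_mono)
    have "\<kappa> * y ^ 2 \<le> card I" using large[OF psubset.prems] I(3) by (simp add: y_def)
    also have "real (card I) = y ^ 3 - z ^ 3"
      using card_Diff_subset[of I A] card_mono[OF psubset.hyps(1) I(1)] I(1) psubset.hyps(1)
      by (simp add: y(1) z(1) finite_subset of_nat_diff)
    also have "\<dots> = (y - z) * (y * y + y * z + z * z)"
      by (simp add: power3_eq_cube algebra_simps)
    also have "\<dots> \<le> (y - z) * (y * y + y * y + y * y)"
      using zy y(2) z(2) by (intro mult_left_mono add_mono mult_mono) auto
    also have "\<dots> = 3 * (y - z) * y ^ 2" by (simp add: power2_eq_square)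
    finally have "\<kappa> \<le> 3 * (y - z)" using y(2) by simp
    then have "(\<kappa> + 3 * z) / \<kappa> \<le> 3 * y / \<kappa>" using \<kappa> by (intro divide_right_mono) auto
    then have "1 + 3 * z / \<kappa> \<le> 3 * y / \<kappa>" using \<kappa> by (simp add: add_divide_distrib)
    then have "real (Suc k) \<le> 3 * root 3 (card A) / \<kappa>" using k by (simp add: y_def z_def)
    moreover have "(if v \<in> I then k else c v) < Suc k" if "v \<in> A" for v
      using c(1) that by (auto simp: less_SucI)
    moreover have "(if u \<in> I then k else c u) \<noteq> (if v \<in> I then k else c v)"
      if "u \<in> A" "v \<in> A" "E u v" for u v
    proof -
      have not_both: "\<not> (u \<in> I \<and> v \<in> I)" using I(2) that(3) by (auto simp: indep_def)
      have ne: "w \<in> A - I \<Longrightarrow> c w \<noteq> k" for w using c(1) by blast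
      show ?thesis
        using not_both ne[of u] ne[of v] c(2)[rule_format, of u v] that by auto
    qed
    ultimately show ?thesis
      by (intro exI[of _ "\<lambda>v. if v \<in> I then k else c v"] exI[of _ "Suc k"] conjI ballI impI)
  qed
qed

end


section \<open>Expansion of extremal graphs\<close>

text \<open>
  The condition says that \<open>V\<close> minimises the ratio of \<open>\<alpha>(A)\<close> to \<open>|A| powr (2/3)\<close> among its subsets, with
  the exponents cleared so that it concerns natural numbers.
\<close>

locale extremal_graph = finite_graph +
  assumes nonempty: "V \<noteq> {}"
    and extremal: "A \<subseteq> V \<Longrightarrow> \<alpha> V ^ 3 * card A ^ 2 \<le> \<alpha> A ^ 3 * card V ^ 2"
begin

lemma card_V_pos: "0 < card V"
  using nonempty finite_V by (simp add: card_gt_0_iff)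

lemma \<alpha>V_pos: "0 < \<alpha> V"
  using \<alpha>_pos[of V] nonempty by simp

lemma extremal_real:
  assumes "A \<subseteq> V"
  shows "(real (card A) / card V) ^ 2 \<le> real (\<alpha> A) ^ 3 / real (\<alpha> V) ^ 3"
proof -
  have "real (\<alpha> V ^ 3 * card A ^ 2) \<le> real (\<alpha> A ^ 3 * card V ^ 2)"
    using extremal[OF assms] by (simp only: of_nat_le_iff)
  then have "real (card A) ^ 2 * real (\<alpha> V) ^ 3 \<le> real (\<alpha> A) ^ 3 * real (card V) ^ 2"
    by (simp add: mult.commute)
  then have "real (card A) ^ 2 / real (card V) ^ 2 \<le> real (\<alpha> A) ^ 3 / real (\<alpha> V) ^ 3"
    using \<alpha>V_pos card_V_pos by (subst frac_le_eq) (auto intro!: divide_nonpos_pos)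
  then show ?thesis by (simp add: power_divide)
qed

lemma \<alpha>_ge_if_card_ge:
  assumes "A \<subseteq> V" "0 \<le> m" "m ^ 3 \<le> (real (card A) / card V) ^ 2"
  shows "m * \<alpha> V \<le> \<alpha> A"
proof -
  have "(m * \<alpha> V) ^ 3 \<le> (real (card A) / card V) ^ 2 * real (\<alpha> V) ^ 3"
    using assms(3) by (simp add: power_mult_distrib mult_right_mono)
  also have "\<dots> \<le> real (\<alpha> A) ^ 3"
    using extremal_real[OF assms(1)] \<alpha>V_pos by (simp add: pos_le_divide_eq)
  finally show ?thesis
    using power_mono_iff[of "m * \<alpha> V" "real (\<alpha> A)" 3] assms(2) by simp
qed

text \<open>
  The set \<open>T\<close> of vertices outside the closed neighbourhood of \<open>S\<close> satisfies \<open>\<alpha> T \<le> \<alpha> V - \<alpha> S\<close>, and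
  extremality turns this into a bound on the size of \<open>T\<close>.
\<close>

lemma complement_of_closed_nbhd_bound:
  assumes "S \<subseteq> V"
  shows "(1 - real (card (S \<union> nbhd S)) / card V) ^ 2 \<le> (1 - real (\<alpha> S) / \<alpha> V) ^ 3"
proof -
  define T where "T = V - (S \<union> nbhd S)"
  have TV: "T \<subseteq> V" by (auto simp: T_def)
  have "\<alpha> S + \<alpha> T \<le> \<alpha> (S \<union> T)"
    using assms by (intro \<alpha>_additive) (auto simp: T_def)
  also have "\<dots> \<le> \<alpha> V" using assms TV by (intro \<alpha>_mono) auto
  finally have le: "real (\<alpha> T) / \<alpha> V \<le> 1 - real (\<alpha> S) / \<alpha> V"
    using \<alpha>V_pos by (simp add: field_simps)
  have "card T = card V - card (S \<union> nbhd S)" "card (S \<union> nbhd S) \<le> card V"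
    using assms nbhd_subset finite_V
    by (auto simp: T_def intro!: card_Diff_subset card_mono finite_subset_V)
  then have "1 - real (card (S \<union> nbhd S)) / card V = real (card T) / card V"
    using card_V_pos by (simp add: of_nat_diff diff_divide_distrib)
  then have "(1 - real (card (S \<union> nbhd S)) / card V) ^ 2 \<le> (real (\<alpha> T) / \<alpha> V) ^ 3"
    using extremal_real[OF TV] by (simp add: power_divide)
  also have "\<dots> \<le> (1 - real (\<alpha> S) / \<alpha> V) ^ 3"
    using le by (intro power_mono) auto
  finally show ?thesis .
qed

text \<open>
  Linear forms of the preceding bound.  The factor \<open>5/4\<close>, which is available as long as \<open>\<alpha> S\<close> is at
  most half of \<open>\<alpha> V\<close>, makes neighbourhoods expand even after the loss of some vertices.
\<close>

lemma card_closed_nbhd_ge: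
  assumes "S \<subseteq> V"
  shows "real (card V) * \<alpha> S \<le> \<alpha> V * card (S \<union> nbhd S)"
proof -
  define \<tau> where "\<tau> = 1 - real (card (S \<union> nbhd S)) / card V"
  define m where "m = real (\<alpha> S) / \<alpha> V"
  have m: "0 \<le> m" "m \<le> 1"
    using \<alpha>_mono[OF assms] \<alpha>V_pos by (auto simp: m_def)
  have "\<tau> ^ 2 \<le> (1 - m) ^ 3" using complement_of_closed_nbhd_bound[OF assms] by (simp add: \<tau>_def m_def)
  also have "\<dots> \<le> (1 - m) ^ 2" using m by (intro power_decreasing) auto
  finally have "\<tau> \<le> 1 - m" using m by (intro power2_le_imp_le[of \<tau>]) auto
  then show ?thesis
    using card_V_pos \<alpha>V_pos by (simp add: \<tau>_def m_def field_simps)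
qed

lemma card_closed_nbhd_ge_small:
  assumes "S \<subseteq> V" "2 * \<alpha> S \<le> \<alpha> V"
  shows "5 * real (card V) * \<alpha> S \<le> 4 * \<alpha> V * card (S \<union> nbhd S)"
proof -
  define \<tau> where "\<tau> = 1 - real (card (S \<union> nbhd S)) / card V"
  define m where "m = real (\<alpha> S) / \<alpha> V"
  have "2 * real (\<alpha> S) \<le> \<alpha> V" using assms(2) by linarith
  then have m: "0 \<le> m" "m \<le> 1 / 2"
    using \<alpha>V_pos by (auto simp: m_def divide_le_eq)
  have "\<tau> ^ 2 \<le> (1 - m) ^ 3" using complement_of_closed_nbhd_bound[OF assms(1)] by (simp add: \<tau>_def m_def)
  \<comment> \<open>The quadratic \<open>m\<^sup>2 - 23/16 m + 1/2\<close> is decreasing on \<open>[0, 1/2]\<close> and positive at \<open>1/2\<close>.\<close>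
  also have "\<dots> = (1 - 5 / 4 * m) ^ 2 - m * ((m - 23 / 32) ^ 2 - 17 / 1024)"
    by (simp add: power2_eq_square power3_eq_cube algebra_simps)
  also have "\<dots> \<le> (1 - 5 / 4 * m) ^ 2"
  proof -
    have "(7 / 32 :: real) ^ 2 \<le> (23 / 32 - m) ^ 2" using m by (intro power_mono) auto
    then have "0 \<le> (m - 23 / 32) ^ 2 - 17 / 1024"
      by (simp add: power2_commute power2_eq_square[of "7/32"])
    then show ?thesis using m by simp
  qed
  finally have "\<tau> \<le> 1 - 5 / 4 * m" using m by (intro power2_le_imp_le[of \<tau>]) auto
  then show ?thesis
    using card_V_pos \<alpha>V_pos by (simp add: \<tau>_def m_def field_simps)
qed

end


section \<open>Short paths between sets of large independence number\<close>

context extremal_graph begin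

text \<open>
  Breadth-first search that never enters \<open>Y\<close>, the set of vertices used by other paths.
\<close>

definition grow :: "'a set \<Rightarrow> 'a set \<Rightarrow> 'a set" where
  "grow Y S = S \<union> (nbhd S - Y)"

text \<open>
  The set \<open>Y\<close> takes away at most a fifth of the guaranteed closed neighbourhood, so \<open>grow Y S\<close> has at
  least \<open>m n\<close> elements for \<open>m = \<alpha> S / \<alpha> V\<close>.  By extremality its independence number is at least
  \<open>\<alpha> V\<close> times \<open>m powr (2/3)\<close>, and \<open>m powr (2/3) \<ge> 5/4 m\<close> since \<open>m \<le> 1/2\<close>.
\<close>

lemma \<alpha>_grow:
  assumes "S \<subseteq> V" "Y \<subseteq> V" "2 * \<alpha> S \<le> \<alpha> V" "4 * card Y * \<alpha> V \<le> \<alpha> S * card V"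
  shows "5 / 4 * real (\<alpha> S) \<le> \<alpha> (grow Y S)"
proof -
  define m where "m = real (\<alpha> S) / \<alpha> V"
  have "2 * real (\<alpha> S) \<le> \<alpha> V" using assms(3) by linarith
  then have m: "0 \<le> m" "m \<le> 1 / 2"
    using \<alpha>V_pos by (auto simp: m_def divide_le_eq)
  have gV: "grow Y S \<subseteq> V" using assms(1) nbhd_subset by (auto simp: grow_def)
  have "card (S \<union> nbhd S) \<le> card (grow Y S \<union> Y)"
    using gV assms(2) by (intro card_mono finite_subset_V) (auto simp: grow_def)
  also have "\<dots> \<le> card (grow Y S) + card Y" by (rule card_Un_le)
  finally have "real (card (S \<union> nbhd S)) \<le> card (grow Y S) + card Y" by linarith
  moreover have "5 / 4 * m * card V \<le> card (S \<union> nbhd S)"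
    using card_closed_nbhd_ge_small[OF assms(1,3)] \<alpha>V_pos by (simp add: m_def field_simps)
  moreover have "real (4 * card Y * \<alpha> V) \<le> real (\<alpha> S * card V)"
    using assms(4) by (simp only: of_nat_le_iff)
  then have "real (card Y) \<le> m * card V / 4"
    using \<alpha>V_pos by (simp add: m_def field_simps)
  ultimately have "m * card V \<le> card (grow Y S)" by linarith
  then have "m \<le> real (card (grow Y S)) / card V"
    using card_V_pos by (simp add: field_simps)
  then have sq: "m ^ 2 \<le> (real (card (grow Y S)) / card V) ^ 2" using m by (intro power_mono)
  have cube: "(5 / 4 * m) ^ 3 \<le> m ^ 2"
  proof -
    have "(5 / 4 * m) ^ 3 = m ^ 2 * (125 / 64 * m)" by (simp add: power2_eq_square power3_eq_cube)
    also have "\<dots> \<le> m ^ 2 * 1" using m by (intro mult_left_mono) auto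
    finally show ?thesis by simp
  qed
  have "5 / 4 * m * \<alpha> V \<le> \<alpha> (grow Y S)"
    using order_trans[OF cube sq] gV m by (intro \<alpha>_ge_if_card_ge) auto
  then show ?thesis using \<alpha>V_pos by (simp add: m_def)
qed

lemma grow_funpow_subset: "A \<subseteq> V - Y \<Longrightarrow> (grow Y ^^ i) A \<subseteq> V - Y"
  using nbhd_subset by (induction i) (auto simp: grow_def)

lemma \<alpha>_grow_funpow:
  assumes "A \<subseteq> V - Y" "Y \<subseteq> V" "t \<le> \<alpha> A" "4 * card Y * \<alpha> V \<le> t * card V"
  shows "\<alpha> V < 2 * \<alpha> ((grow Y ^^ i) A) \<or> (5 / 4) ^ i * real t \<le> \<alpha> ((grow Y ^^ i) A)"
proof (induction i)
  case (Suc i)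
  define S where "S = (grow Y ^^ i) A"
  have S: "S \<subseteq> V - Y" "A \<subseteq> S"
    using grow_funpow_subset[OF assms(1)] unfolding S_def
    by (auto, induction i) (auto simp: grow_def)
  have gV: "grow Y S \<subseteq> V" using S nbhd_subset by (auto simp: grow_def)
  show ?case
  proof (cases "\<alpha> V < 2 * \<alpha> S")
    case True
    moreover have "\<alpha> S \<le> \<alpha> (grow Y S)" using gV by (intro \<alpha>_mono) (auto simp: grow_def)
    ultimately show ?thesis by (simp add: S_def)
  next
    case False
    have "\<alpha> A \<le> \<alpha> S" using S by (intro \<alpha>_mono) auto
    then have "t \<le> \<alpha> S" using assms(3) by linarith
    then have "4 * card Y * \<alpha> V \<le> \<alpha> S * card V"
      using assms(4) by (meson mult_le_mono1 order_trans)
    then have "5 / 4 * real (\<alpha> S) \<le> \<alpha> (grow Y S)"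
      using S False assms(2) by (intro \<alpha>_grow) auto
    moreover have "(5 / 4) ^ i * real t \<le> \<alpha> S"
      using Suc.IH False by (simp add: S_def)
    ultimately show ?thesis by (simp add: S_def)
  qed
qed (use assms(3) in simp)

lemma grow_funpow_walk:
  assumes "A \<subseteq> V - Y" "v \<in> (grow Y ^^ i) A"
  shows "\<exists>xs. xs \<noteq> [] \<and> hd xs \<in> A \<and> last xs = v \<and> successively E xs \<and> set xs \<subseteq> V - Y \<and>
    length xs \<le> i + 1"
  using assms(2)
proof (induction i arbitrary: v)
  case 0
  then show ?case using assms(1) by (intro exI[of _ "[v]"]) auto
next
  case (Suc i)
  have vV: "v \<in> V - Y" using Suc.prems grow_funpow_subset[OF assms(1), of "Suc i"] by blast
  consider "v \<in> (grow Y ^^ i) A" | u where "u \<in> (grow Y ^^ i) A" "E u v"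
    using Suc.prems by (auto simp: grow_def[of Y "(grow Y ^^ i) A"] nbhd_def)
  then show ?case
  proof cases
    case 1
    from Suc.IH[OF this] show ?thesis by (metis le_SucI add_Suc)
  next
    case 2
    from Suc.IH[OF this(1)] obtain xs where "xs \<noteq> []" "hd xs \<in> A" "last xs = u"
      "successively E xs" "set xs \<subseteq> V - Y" "length xs \<le> i + 1" by blast
    then show ?thesis using 2(2) vV
      by (intro exI[of _ "xs @ [v]"]) (auto simp: successively_append_iff)
  qed
qed

text \<open>
  Both searches go on until their independence numbers exceed \<open>\<alpha> V / 2\<close>.  Then the two sets meet or
  are joined by an edge, as otherwise their independence numbers would add up to more than \<open>\<alpha> V\<close>.
\<close>

lemma connecting_path:
  assumes Y: "Y \<subseteq> V" "4 * card Y * \<alpha> V \<le> t * card V"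
    and A: "A \<subseteq> V - Y" "t \<le> \<alpha> A" and B: "B \<subseteq> V - Y" "t \<le> \<alpha> B"
    and r: "\<alpha> V < 2 * ((5 / 4) ^ r * real t)"
  obtains ys where "ys \<noteq> []" "hd ys \<in> A" "last ys \<in> B" "successively E ys" "set ys \<subseteq> V - Y"
    "length ys \<le> 2 * r + 2" "distinct ys"
proof -
  define S where "S = (grow Y ^^ r) A"
  define T where "T = (grow Y ^^ r) B"
  have big: "\<alpha> V < 2 * \<alpha> S" "\<alpha> V < 2 * \<alpha> T"
    using \<alpha>_grow_funpow[OF A(1) Y(1) A(2) Y(2), of r] \<alpha>_grow_funpow[OF B(1) Y(1) B(2) Y(2), of r] r
    unfolding S_def T_def by linarith+
  have ST: "S \<subseteq> V" "T \<subseteq> V"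
    using grow_funpow_subset[OF A(1)] grow_funpow_subset[OF B(1)] unfolding S_def T_def by blast+
  have "S \<inter> T \<noteq> {} \<or> T \<inter> nbhd S \<noteq> {}"
  proof (rule ccontr)
    assume "\<not> ?thesis"
    then have "\<alpha> S + \<alpha> T \<le> \<alpha> (S \<union> T)" using ST by (intro \<alpha>_additive) auto
    also have "\<dots> \<le> \<alpha> V" using ST by (intro \<alpha>_mono) auto
    finally show False using big by linarith
  qed
  then obtain u v where uv: "u \<in> S" "v \<in> T" "u = v \<or> E u v"
    by (auto simp: nbhd_def)
  obtain xs where xs: "xs \<noteq> []" "hd xs \<in> A" "last xs = u" "successively E xs"
    "set xs \<subseteq> V - Y" "length xs \<le> r + 1"
    using grow_funpow_walk[OF A(1)] uv(1) unfolding S_def by blast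
  obtain zs where zs: "zs \<noteq> []" "hd zs \<in> B" "last zs = v" "successively E zs"
    "set zs \<subseteq> V - Y" "length zs \<le> r + 1"
    using grow_funpow_walk[OF B(1)] uv(2) unfolding T_def by blast
  have rev: "successively E (rev zs)"
    using zs(4) sym by (auto simp: successively_rev elim: successively_mono)
  define ws where "ws = (if u = v then xs @ tl (rev zs) else xs @ rev zs)"
  have rz: "rev zs = v # tl (rev zs)" using zs(1,3) by (metis hd_rev list.collapse rev_is_Nil_conv)
  have tl: "tl (rev zs) = [] \<or> E v (hd (tl (rev zs)))" "successively E (tl (rev zs))"
    using rev by (subst (asm) rz, auto simp: successively_Cons)+
  have sub: "set (tl (rev zs)) \<subseteq> set zs" using rz by (metis set_rev set_subset_Cons)
  have last: "last (v # tl (rev zs)) \<in> B" using zs(1,2) rz by (metis last_rev)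
  have "ws \<noteq> []" "hd ws \<in> A" using xs by (auto simp: ws_def)
  moreover have "last ws \<in> B" 
    using last xs(3) zs(1,2) by (auto simp: ws_def last_rev split: if_splits)
  moreover have "successively E ws"
    using xs(3,4) tl rev uv(3) zs(1,3) by (auto simp: ws_def successively_append_iff hd_rev)
  moreover have "set ws \<subseteq> V - Y"
    using xs(5) zs(5) sub by (auto simp: ws_def)
  moreover have "length ws \<le> 2 * r + 2" using xs(6) zs(6) by (auto simp: ws_def)
  ultimately show ?thesis using walk_imp_path that by metis
qed

end


section \<open>Disjoint paths between most pairs of a vertex set\<close>

context extremal_graph begin

definition missing :: "'a set \<Rightarrow> ('a \<times> 'a) set" where
  "missing P = {(x, y). x \<in> P \<and> y \<in> P \<and> x < y \<and> \<not> E x y}"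

lemma finite_missing: "finite P \<Longrightarrow> finite (missing P)"
  by (rule finite_subset[of _ "P \<times> P"]) (auto simp: missing_def)

definition routing :: "'a set \<Rightarrow> nat \<Rightarrow> ('a \<times> 'a) set \<Rightarrow> ('a \<times> 'a \<Rightarrow> 'a list) \<Rightarrow> bool" where
  "routing P l D \<rho> \<longleftrightarrow> D \<subseteq> missing P \<and>
    (\<forall>e\<in>D. links E (fst e) (\<rho> e) (snd e) \<and> set (\<rho> e) \<subseteq> V - P \<and> length (\<rho> e) \<le> l) \<and>
    (\<forall>e\<in>D. \<forall>f\<in>D. e \<noteq> f \<longrightarrow> set (\<rho> e) \<inter> set (\<rho> f) = {})"

lemma routing_subset: "routing P l D \<rho> \<Longrightarrow> D' \<subseteq> D \<Longrightarrow> routing P l D' \<rho>"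
  unfolding routing_def by blast

lemma routing_extend:
  assumes R: "routing P l D \<rho>" and e: "(x, y) \<in> missing P" "(x, y) \<notin> D"
    and ys: "ys \<noteq> []" "E x (hd ys)" "E (last ys) y" "successively E ys" "distinct ys" "length ys \<le> l"
    and fresh: "set ys \<subseteq> V - (P \<union> (\<Union>e\<in>D. set (\<rho> e)))"
  shows "routing P l (insert (x, y) D) (\<rho>((x, y) := ys))"
proof -
  have "links E x ys y"
    using ys by (auto simp: links_def successively_Cons successively_append_iff)
  moreover have "set ys \<inter> set (\<rho> e) = {}" if "e \<in> D" for e using fresh that by auto
  ultimately show ?thesis
    using R e ys(6) fresh unfolding routing_def by auto
qed

text \<open>
  Take a routing of as many pairs as possible.  Call a vertex of \<open>P\<close> alive if those
  neighbours that the routing leaves free have independence number at least \<open>t\<close>, and dead otherwise.  Two alive vertices are connected by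
  a further path, so \<open>connecting_path\<close> and maximality show that all pairs of alive vertices are
  joined.  If most of \<open>P\<close> were dead, some block would contain a set \<open>S\<close> of at least \<open>t / 2\<close> dead vertices.
  As \<open>S\<close> is independent, its closed neighbourhood has at least \<open>|S| n / \<alpha> V\<close> elements; but each dead
  vertex has at most \<open>n / (4 \<alpha> V)\<close> free neighbours, and the budget leaves at most \<open>t n / (4 \<alpha> V)\<close> vertices
  that are not free.
\<close>

lemma routing_to_most_of_block_union:
  assumes fin: "finite \<B>" and disj: "pairwise disjnt \<B>"
    and blocks: "\<And>B. B \<in> \<B> \<Longrightarrow> B \<subseteq> V \<and> indep B \<and> card B = t" and t: "0 < t"
    and P: "P = \<Union>\<B>"
    and big: "\<And>A. A \<subseteq> V \<Longrightarrow> card V \<le> 4 * \<alpha> V * card A \<Longrightarrow> t \<le> \<alpha> A"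
    and r: "\<alpha> V < 2 * ((5 / 4) ^ r * real t)"
    and budget: "4 * \<alpha> V * (card P + card (missing P) * (2 * r + 2)) \<le> t * card V"
  obtains Q \<rho> where "Q \<subseteq> P" "card P \<le> 2 * card Q" "routing P (2 * r + 2) (missing Q) \<rho>"
proof -
  define l where "l = 2 * r + 2"
  have PV: "P \<subseteq> V" using P blocks by auto
  have finP: "finite P" using PV finite_subset_V by blast
  have "routing P l {} (\<lambda>_. [])" by (simp add: routing_def)
  moreover have "card D \<le> card (missing P)" if "routing P l D \<rho>" for D \<rho>
    using that finite_missing[OF finP] by (auto simp: routing_def intro: card_mono)
  ultimately have "\<exists>R. (case R of (D, \<rho>) \<Rightarrow> routing P l D \<rho>) \<and>
      (\<forall>R'. (case R' of (D, \<rho>) \<Rightarrow> routing P l D \<rho>) \<longrightarrow> card (fst R') \<le> card (fst R))"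
    by (intro ex_has_greatest_nat[of _ "({}, \<lambda>_. [])" _ "Suc (card (missing P))"])
      (auto simp: less_Suc_eq_le)
  then obtain D \<rho> where R: "routing P l D \<rho>"
    and max: "\<And>D' \<rho>'. routing P l D' \<rho>' \<Longrightarrow> card D' \<le> card D" by auto
  have D: "D \<subseteq> missing P" using R by (simp add: routing_def)
  have finD: "finite D" using D finite_missing[OF finP] finite_subset by blast
  define Y where "Y = P \<union> (\<Union>e\<in>D. set (\<rho> e))"
  have YV: "Y \<subseteq> V" using R PV by (auto simp: Y_def routing_def)
  have "card Y \<le> card P + (\<Sum>e\<in>D. card (set (\<rho> e)))"
    unfolding Y_def by (rule order_trans[OF card_Un_le add_left_mono[OF card_UN_le[OF finD]]])
  also have "(\<Sum>e\<in>D. card (set (\<rho> e))) \<le> (\<Sum>e\<in>D. l)"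
    using R by (intro sum_mono order_trans[OF card_length]) (auto simp: routing_def)
  also have "\<dots> \<le> card (missing P) * l"
    using card_mono[OF finite_missing[OF finP] D] by simp
  finally have "4 * \<alpha> V * card Y \<le> 4 * \<alpha> V * (card P + card (missing P) * l)" by simp
  also have "\<dots> \<le> t * card V" using budget unfolding l_def .
  finally have Y: "4 * card Y * \<alpha> V \<le> t * card V" by (simp only: ac_simps)
  define Q where "Q = {x \<in> P. t \<le> \<alpha> (nbhd {x} - Y)}"
  have "missing Q \<subseteq> D"
  proof (rule ccontr)
    assume "\<not> missing Q \<subseteq> D"
    then obtain x y where xy: "(x, y) \<in> missing Q" "(x, y) \<notin> D" by auto
    then have live: "t \<le> \<alpha> (nbhd {x} - Y)" "t \<le> \<alpha> (nbhd {y} - Y)" "(x, y) \<in> missing P"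
      by (auto simp: missing_def Q_def)
    obtain ys where ys: "ys \<noteq> []" "hd ys \<in> nbhd {x} - Y" "last ys \<in> nbhd {y} - Y"
      "successively E ys" "set ys \<subseteq> V - Y" "length ys \<le> 2 * r + 2" "distinct ys"
      by (rule connecting_path[OF YV Y _ live(1) _ live(2) r]) (use nbhd_subset in auto)
    have "routing P l (insert (x, y) D) (\<rho>((x, y) := ys))"
      using ys sym by (intro routing_extend[OF R live(3) xy(2)]) (auto simp: nbhd_def l_def Y_def)
    from max[OF this] show False using finD xy(2) by simp
  qed
  then have RQ: "routing P l (missing Q) \<rho>" using R routing_subset by blast
  have "card P \<le> 2 * card Q"
  proof (rule ccontr)
    assume few: "\<not> card P \<le> 2 * card Q"
    define Dead where "Dead = P - Q"
    have "\<exists>B\<in>\<B>. t \<le> 2 * card (B \<inter> Dead)"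
    proof (rule ccontr)
      assume "\<not> ?thesis"
      then have "2 * card (B \<inter> Dead) \<le> t" if "B \<in> \<B>" for B using that by fastforce
      then have "(\<Sum>B\<in>\<B>. 2 * card (B \<inter> Dead)) \<le> (\<Sum>B\<in>\<B>. card B)"
        using blocks by (intro sum_mono) auto
      moreover have "card P = (\<Sum>B\<in>\<B>. card B)"
        unfolding P using disj blocks finite_subset_V by (intro card_Union_disjoint) auto
      moreover have "card Dead = (\<Sum>B\<in>\<B>. card (B \<inter> Dead))"
      proof -
        have "Dead = (\<Union>B\<in>\<B>. B \<inter> Dead)" using P by (auto simp: Dead_def)
        moreover have "card (\<Union>B\<in>\<B>. B \<inter> Dead) = (\<Sum>B\<in>\<B>. card (B \<inter> Dead))"
          using fin finP disj by (intro card_UN_disjoint)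
            (auto simp: Dead_def dest: pairwiseD simp: disjnt_iff)
        ultimately show ?thesis by simp
      qed
      moreover have "card Dead = card P - card Q"
        unfolding Dead_def using finP by (intro card_Diff_subset) (auto simp: Q_def intro: finite_subset)
      ultimately show False using few by (simp add: sum_distrib_left[symmetric])
    qed
    then obtain B where B: "B \<in> \<B>" "t \<le> 2 * card (B \<inter> Dead)" by blast
    define S where "S = B \<inter> Dead"
    have SV: "S \<subseteq> V" "finite S" using PV finP by (auto simp: S_def Dead_def)
    have "indep S" using B blocks indep_subset unfolding S_def by blast
    then have "card S \<le> \<alpha> S" using indep_card_le_\<alpha>[OF SV(1)] by blast
    then have \<alpha>S: "\<alpha> S = card S" using \<alpha>_le_card[OF SV(1)] by simp
    have dead: "4 * \<alpha> V * card (nbhd {x} - Y) \<le> card V" if "x \<in> S" for x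
    proof (rule ccontr)
      assume "\<not> ?thesis"
      then have "t \<le> \<alpha> (nbhd {x} - Y)" using big[of "nbhd {x} - Y"] nbhd_subset by auto
      then show False using that by (auto simp: S_def Dead_def Q_def)
    qed
    have "S \<union> nbhd S \<subseteq> Y \<union> (\<Union>x\<in>S. nbhd {x} - Y)"
      by (auto simp: S_def Dead_def Y_def nbhd_def)
    then have "card (S \<union> nbhd S) \<le> card (Y \<union> (\<Union>x\<in>S. nbhd {x} - Y))"
      using YV nbhd_subset by (intro card_mono finite_subset_V) auto
    also have "\<dots> \<le> card Y + (\<Sum>x\<in>S. card (nbhd {x} - Y))"
      by (rule order_trans[OF card_Un_le add_left_mono[OF card_UN_le[OF SV(2)]]])
    finally have "card (S \<union> nbhd S) \<le> card Y + (\<Sum>x\<in>S. card (nbhd {x} - Y))" .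
    from mult_le_mono2[OF this, of "4 * \<alpha> V"]
    have "4 * \<alpha> V * card (S \<union> nbhd S) \<le>
        4 * card Y * \<alpha> V + (\<Sum>x\<in>S. 4 * \<alpha> V * card (nbhd {x} - Y))"
      by (simp only: sum_distrib_left distrib_left ac_simps)
    also have "\<dots> \<le> t * card V + (\<Sum>x\<in>S. card V)"
      using Y dead by (intro add_mono sum_mono) auto
    also have "\<dots> \<le> 2 * card S * card V + card S * card V"
      using B(2) by (simp add: S_def)
    finally have "4 * \<alpha> V * card (S \<union> nbhd S) \<le> 3 * (card V * card S)" by (simp add: mult.commute)
    moreover have "card V * card S \<le> \<alpha> V * card (S \<union> nbhd S)"
      using card_closed_nbhd_ge[OF SV(1)] unfolding \<alpha>S by (simp only: of_nat_le_iff flip: of_nat_mult)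
    moreover have "0 < card V * card S" using card_V_pos B(2) t by (simp add: S_def)
    ultimately show False by linarith
  qed
  then show ?thesis using that[of Q \<rho>] RQ by (auto simp: Q_def l_def)
qed

end


section \<open>Unions of independent sets with few nonadjacent pairs\<close>

context extremal_graph begin

definition non_nbrs :: "'a set \<Rightarrow> 'a \<Rightarrow> 'a set" where
  "non_nbrs A v = {w \<in> A. w \<noteq> v \<and> \<not> E v w}"

lemma sum_card_non_nbrs_commute:
  assumes "finite A" "finite B"
  shows "(\<Sum>v\<in>A. card (non_nbrs B v)) = (\<Sum>w\<in>B. card (non_nbrs A w))"
proof -
  have "(\<Sum>v\<in>A. card (non_nbrs B v)) = card (SIGMA v:A. non_nbrs B v)"
    using assms by (subst card_SigmaI) (auto simp: non_nbrs_def)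
  also have "\<dots> = card (prod.swap ` (SIGMA v:A. non_nbrs B v))"
    by (simp add: card_image)
  also have "prod.swap ` (SIGMA v:A. non_nbrs B v) = (SIGMA w:B. non_nbrs A w)"
    using sym by (auto simp: non_nbrs_def image_iff)
  also have "card \<dots> = (\<Sum>w\<in>B. card (non_nbrs A w))"
    using assms by (subst card_SigmaI) (auto simp: non_nbrs_def)
  finally show ?thesis .
qed

lemma card_missing_Un:
  assumes "finite P" "finite B"
  shows "card (missing (P \<union> B)) \<le> card (missing P) + card B ^ 2 + (\<Sum>w\<in>B. card (non_nbrs P w))"
proof -
  define X where "X = missing (P \<union> B) - (missing P \<union> B \<times> B)"
  define f where "f = (\<lambda>(x, y). if x \<in> B then (x, y) else (y, x))"
  have "inj_on f X"
    by (auto simp: inj_on_def f_def X_def missing_def split: if_splits)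
  moreover have "f ` X \<subseteq> (SIGMA w:B. non_nbrs P w)"
    using sym by (auto simp: f_def X_def missing_def non_nbrs_def)
  ultimately have "card X \<le> card (SIGMA w:B. non_nbrs P w)"
    using assms by (intro card_inj_on_le finite_SigmaI) (auto simp: non_nbrs_def)
  also have "\<dots> = (\<Sum>w\<in>B. card (non_nbrs P w))"
    using assms by (subst card_SigmaI) (auto simp: non_nbrs_def)
  finally have X: "card X \<le> (\<Sum>w\<in>B. card (non_nbrs P w))" .
  have "card (missing (P \<union> B)) \<le> card (missing P \<union> B \<times> B \<union> X)"
    using assms finite_missing[of P] finite_missing[of "P \<union> B"]
    by (intro card_mono) (auto simp: X_def)
  also have "\<dots> \<le> card (missing P) + card (B \<times> B) + card X"
    by (intro order_trans[OF card_Un_le add_right_mono[OF card_Un_le]])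
  finally show ?thesis using X by (simp add: card_cartesian_product power2_eq_square)
qed

text \<open>
  The blocks are chosen one after the other.  A vertex of \<open>W\<close> has on
  average at most \<open>q |P|\<close> non-neighbours in the union \<open>P\<close> of the blocks chosen so far, by double counting,
  so at most a quarter of \<open>W\<close> has more than \<open>4 q |P|\<close>.  Without these vertices and without \<open>P\<close>, at least
  half of \<open>W\<close> remains, and it contains the next block.  A block that follows \<open>b\<close> others thus contributes
  at most \<open>4 q (b t) t\<close> pairs to the second term, and its inner pairs contribute \<open>t\<^sup>2\<close> to the first.
\<close>

lemma sparse_block_family:
  fixes q :: real
  assumes W: "W \<subseteq> V" and t: "0 < t"
    and large: "\<And>U. U \<subseteq> W \<Longrightarrow> card W \<le> 2 * card U \<Longrightarrow> t \<le> \<alpha> U"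
    and q: "0 < q" and few: "\<And>v. v \<in> W \<Longrightarrow> real (card (non_nbrs W v)) \<le> q * card W"
  shows "4 * b * t \<le> card W \<Longrightarrow> \<exists>\<B>. finite \<B> \<and> card \<B> = b \<and> pairwise disjnt \<B> \<and>
    (\<forall>B\<in>\<B>. B \<subseteq> W \<and> indep B \<and> card B = t) \<and>
    real (card (missing (\<Union>\<B>))) \<le> real b * real t ^ 2 + 2 * q * real b * (real b - 1) * real t ^ 2"
proof (induction b)
  case 0
  show ?case by (intro exI[of _ "{}"]) (simp add: missing_def)
next
  case (Suc b)
  have bt: "4 * (b * t) \<le> card W" using Suc.prems by (simp add: distrib_right)
  then have "4 * b * t \<le> card W" by (simp only: ac_simps)
  from Suc.IH[OF this] obtain \<B> where IH: "finite \<B> \<and> card \<B> = b \<and> pairwise disjnt \<B> \<and>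
    (\<forall>B\<in>\<B>. B \<subseteq> W \<and> indep B \<and> card B = t) \<and>
    real (card (missing (\<Union>\<B>))) \<le> real b * real t ^ 2 + 2 * q * real b * (real b - 1) * real t ^ 2" ..
  then have \<B>: "finite \<B>" "card \<B> = b" "pairwise disjnt \<B>"
    "\<And>B. B \<in> \<B> \<Longrightarrow> B \<subseteq> W \<and> indep B \<and> card B = t"
    by (elim conjE; (assumption | blast))+
  note budget = IH[THEN conjunct2, THEN conjunct2, THEN conjunct2, THEN conjunct2]
  define P where "P = \<Union>\<B>"
  have PW: "P \<subseteq> W" using \<B>(4) by (auto simp: P_def)
  have finW: "finite W" and finP: "finite P" using W PW finite_subset_V by auto
  have "card P = (\<Sum>B\<in>\<B>. card B)"
    unfolding P_def using \<B>(3,4) finW by (intro card_Union_disjoint) (auto intro: finite_subset)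
  then have cardP: "card P = b * t" using \<B>(2,4) by simp
  define bad where "bad = {w \<in> W. 4 * q * card P < card (non_nbrs P w)}"
  have total: "(\<Sum>w\<in>W. real (card (non_nbrs P w))) \<le> card P * (q * card W)"
  proof -
    have "(\<Sum>w\<in>W. real (card (non_nbrs P w))) = (\<Sum>v\<in>P. real (card (non_nbrs W v)))"
      using sum_card_non_nbrs_commute[OF finP finW] by (simp flip: of_nat_sum)
    also have "\<dots> \<le> (\<Sum>v\<in>P. q * card W)" using few PW by (intro sum_mono) auto
    finally show ?thesis by simp
  qed
  have bad: "4 * card bad \<le> card W"
  proof (cases "P = {}")
    case True
    then show ?thesis by (simp add: bad_def non_nbrs_def)
  next
    case False
    then have pos: "0 < q * card P" using q finP by (simp add: card_gt_0_iff)
    have "(q * card P) * (4 * real (card bad)) = (\<Sum>w\<in>bad. 4 * q * card P)" by simp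
    also have "\<dots> \<le> (\<Sum>w\<in>bad. real (card (non_nbrs P w)))"
      by (intro sum_mono) (simp add: bad_def)
    also have "\<dots> \<le> (\<Sum>w\<in>W. real (card (non_nbrs P w)))"
      using finW by (intro sum_mono2) (auto simp: bad_def)
    also have "\<dots> \<le> (q * card P) * card W" using total by (simp add: ac_simps)
    finally have "4 * real (card bad) \<le> card W" using pos by (simp only: mult_le_cancel_left_pos)
    then show ?thesis by linarith
  qed
  define U where "U = W - P - bad"
  have "card W \<le> card (U \<union> (P \<union> bad))"
    using finW finP by (intro card_mono) (auto simp: U_def bad_def)
  also have "\<dots> \<le> card U + (card P + card bad)"
    by (intro order_trans[OF card_Un_le add_left_mono[OF card_Un_le]])
  finally have "card W \<le> 2 * card U" using bad cardP bt by linarith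
  then have "t \<le> \<alpha> U" by (intro large) (auto simp: U_def)
  moreover have UV: "U \<subseteq> V" using W by (auto simp: U_def)
  ultimately obtain B where B: "B \<subseteq> U" "indep B" "card B = t" using indep_of_card by metis
  have finB: "finite B" using B(1) UV finite_subset_V by auto
  have BP: "B \<inter> P = {}" using B(1) by (auto simp: U_def)
  have "B \<noteq> {}" using B(3) t by auto
  then have new: "B \<notin> \<B>" using BP by (auto simp: P_def)
  have "(\<Sum>w\<in>B. real (card (non_nbrs P w))) \<le> (\<Sum>w\<in>B. 4 * q * card P)"
    using B(1) by (intro sum_mono) (fastforce simp: U_def bad_def)
  also have "\<dots> = 4 * q * real b * real t ^ 2" using B(3) cardP by (simp add: power2_eq_square)
  finally have cross: "(\<Sum>w\<in>B. real (card (non_nbrs P w))) \<le> 4 * q * real b * real t ^ 2" .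
  have "real (card (missing (P \<union> B))) \<le>
      real (card (missing P) + card B ^ 2 + (\<Sum>w\<in>B. card (non_nbrs P w)))"
    using card_missing_Un[OF finP finB] by (simp only: of_nat_le_iff)
  also have "\<dots> \<le> (real b * real t ^ 2 + 2 * q * real b * (real b - 1) * real t ^ 2) + real t ^ 2 + 4 * q * real b * real t ^ 2"
    using budget cross B(3) by (simp add: P_def)
  also have "\<dots> = real (Suc b) * real t ^ 2 + 2 * q * real (Suc b) * (real (Suc b) - 1) * real t ^ 2"
    by (simp add: algebra_simps)
  finally have "real (card (missing (\<Union>(insert B \<B>)))) \<le> \<dots>"
    by (simp add: P_def Un_commute)
  moreover have "pairwise disjnt (insert B \<B>)"
    using \<B>(3) BP by (auto simp: pairwise_insert disjnt_def P_def)
  ultimately show ?case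
    using \<B>(1,2,4) B new by (intro exI[of _ "insert B \<B>"]) (auto simp: U_def)
qed

end


section \<open>A vertex set of the right density\<close>

lemma fourth_power_times_exp_le:
  assumes "0 \<le> (y :: real)"
  shows "y ^ 4 * exp (- y / 40) \<le> 64 * 40 ^ 4"
proof -
  have "(y / 40) ^ 2 / 8 \<le> exp (y / 80)"
    using exp_lower_Taylor_quadratic[of "y / 80"] assms by (simp add: power2_eq_square)
  then have "((y / 40) ^ 2 / 8) ^ 2 \<le> exp (y / 80) ^ 2" by (intro power_mono) auto
  also have "\<dots> = exp (y / 40)" by (simp flip: exp_of_nat_mult)
  finally have "y ^ 4 \<le> 64 * 40 ^ 4 * exp (y / 40)" by (simp add: field_simps)
  then show ?thesis by (simp add: exp_minus field_simps)
qed

context extremal_graph begin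

text \<open>
  The set \<open>W\<close> will contain the branch vertices, \<open>t\<close> will be the size of the blocks, and \<open>q\<close> bounds the
  proportion of nonadjacent pairs.

  If all sets of size \<open>n / (4 \<alpha> V)\<close> have independence number at least \<open>L / 4\<close>, then \<open>W = V\<close> and \<open>q = 1\<close>
  will do.  Otherwise extremality bounds \<open>\<alpha> V\<close> by \<open>L\<^sup>3 / 4\<close>.  Let \<open>j\<close> be least such
  that some set \<open>W\<close> with at least \<open>n exp (- \<eta> j)\<close> elements has independence number at most \<open>j\<close>, where
  \<open>\<eta> j = (2 L - sqrt (L j)) / 20\<close>.  Minimality bounds the size of all sets with a smaller independence
  number, and the four properties of \<open>\<eta>\<close> that matter are:
  \<^item> \<open>\<eta> j \<ge> 3 L / 40\<close> for \<open>j \<le> L / 4\<close>, so that sets of size \<open>n / L\<^sup>3\<close> have independence number at least \<open>j\<close>;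
  \<^item> \<open>\<eta> j \<le> L / 10\<close>, so that \<open>W\<close> has at least \<open>n powr (9/10)\<close> elements;
  \<^item> \<open>\<eta> i - \<eta> j \<ge> ln 2\<close> for \<open>i \<le> j / 4\<close>, so that halves of \<open>W\<close> have independence number at least \<open>j / 4\<close>;
  \<^item> \<open>\<eta> (j - 1) - \<eta> j \<ge> sqrt (L / j) / 40\<close>, which makes the non-neighbourhoods so small that
    \<open>q L\<^sup>2\<close> is bounded by a multiple of \<open>j\<^sup>2\<close>.  The range of \<open>\<eta>\<close> can be as small as \<open>O(L)\<close> because the
    sum of \<open>sqrt (L / j)\<close> over \<open>j \<le> L\<close> is \<open>O(L)\<close>.
\<close>

lemma dense_part:
  defines "L \<equiv> ln (real (card V))"
  assumes L: "1600 \<le> L" "L ^ 3 \<le> exp (3 * L / 40)"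
  obtains W t and q :: real where "W \<subseteq> V" "exp (9 / 10 * L) \<le> card W" "0 < t" "real t \<le> L" "0 < q"
    "q * L ^ 2 \<le> 3 * 10 ^ 9 * real t ^ 2"
    "\<And>A. A \<subseteq> V \<Longrightarrow> card V \<le> 4 * \<alpha> V * card A \<Longrightarrow> t \<le> \<alpha> A"
    "\<And>U. U \<subseteq> W \<Longrightarrow> card W \<le> 2 * card U \<Longrightarrow> t \<le> \<alpha> U"
    "\<And>v. v \<in> W \<Longrightarrow> real (card (non_nbrs W v)) \<le> q * card W"
proof -
  have n: "exp L = card V" using card_V_pos by (simp add: L_def)
  define t0 where "t0 = nat \<lceil>L / 4\<rceil>"
  show ?thesis
  proof (cases "\<forall>A \<subseteq> V. card V \<le> 4 * \<alpha> V * card A \<longrightarrow> t0 \<le> \<alpha> A")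
    case True
    have t0: "L / 4 \<le> t0" "t0 \<le> L / 4 + 1" using L(1) unfolding t0_def by linarith+
    show ?thesis
    proof (rule that[of V t0 1])
      show "exp (9 / 10 * L) \<le> card V" using L(1) by (simp flip: n)
      show "1 * L ^ 2 \<le> 3 * 10 ^ 9 * real t0 ^ 2"
      proof -
        have "L ^ 2 \<le> (4 * real t0) ^ 2" using t0 L(1) by (intro power_mono) auto
        also have "\<dots> \<le> 3 * 10 ^ 9 * real t0 ^ 2" by (simp add: power_mult_distrib)
        finally show ?thesis by simp
      qed
      show "t0 \<le> \<alpha> U" if "U \<subseteq> V" "card V \<le> 2 * card U" for U
      proof -
        have "2 * card U \<le> 4 * \<alpha> V * card U" using \<alpha>V_pos by simp
        then show ?thesis using True that by (meson order_trans)
      qed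
      show "real (card (non_nbrs V v)) \<le> 1 * real (card V)" if "v \<in> V" for v
        using finite_V by (auto simp: non_nbrs_def intro: card_mono)
    qed (use True t0 L(1) in auto)
  next
    case False
    then obtain A where A: "A \<subseteq> V" "card V \<le> 4 * \<alpha> V * card A" "\<alpha> A < t0" by auto
    have \<alpha>A: "real (\<alpha> A) \<le> L / 4" using A(3) unfolding t0_def by linarith
    define \<eta> where "\<eta> = (\<lambda>j::nat. (2 * L - sqrt (L * j)) / 20)"
    have \<eta>_ge: "3 * L / 40 \<le> \<eta> j" if "real j \<le> L / 4" for j
    proof -
      have "sqrt (L * j) \<le> sqrt ((L / 2) ^ 2)"
        using that L(1) by (intro real_sqrt_le_mono) (simp add: power2_eq_square field_simps)
      then show ?thesis using L(1) by (simp add: \<eta>_def)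
    qed
    have real_le: "real (card V) \<le> 4 * real (\<alpha> V) * real (card B)"
      if "card V \<le> 4 * \<alpha> V * card B" for B
    proof -
      have "real (card V) \<le> real (4 * \<alpha> V * card B)" using that by (simp only: of_nat_le_iff)
      then show ?thesis by simp
    qed
    have small: "card V \<le> L ^ 3 * card B" if "B \<subseteq> V" "card V \<le> 4 * \<alpha> V * card B" for B
    proof -
      have cA: "0 < card A" using A(2) card_V_pos by (cases "card A") auto
      have "real (\<alpha> V) ^ 3 * real (card A) ^ 2 \<le> real (\<alpha> A) ^ 3 * real (card V) ^ 2"
        using extremal[OF A(1)] by (metis of_nat_le_iff of_nat_mult of_nat_power)
      also have "\<dots> \<le> real (\<alpha> A) ^ 3 * (4 * real (\<alpha> V) * real (card A)) ^ 2"
        using real_le[OF A(2)] by (intro mult_left_mono power_mono) auto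
      finally have "(real (\<alpha> V) ^ 2 * real (card A) ^ 2) * real (\<alpha> V) \<le>
          (real (\<alpha> V) ^ 2 * real (card A) ^ 2) * (16 * real (\<alpha> A) ^ 3)"
        by (simp add: power2_eq_square power3_eq_cube ac_simps)
      then have "real (\<alpha> V) \<le> 16 * real (\<alpha> A) ^ 3"
        using \<alpha>V_pos cA by (simp add: mult_le_cancel_left)
      also have "\<dots> \<le> 16 * (L / 4) ^ 3" using \<alpha>A by (intro mult_left_mono power_mono) auto
      finally have "4 * real (\<alpha> V) \<le> L ^ 3" by (simp add: power_divide)
      then have "4 * real (\<alpha> V) * card B \<le> L ^ 3 * card B" by (intro mult_right_mono) auto
      moreover have "real (card V) \<le> 4 * real (\<alpha> V) * card B"
        using real_le[OF that(2)] .
      ultimately show ?thesis by linarith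
    qed
    have small': "card V * exp (- \<eta> i) \<le> card B"
      if "B \<subseteq> V" "card V \<le> 4 * \<alpha> V * card B" "real i \<le> L / 4" for B i
    proof -
      have "card V * exp (- \<eta> i) \<le> card V * exp (- (3 * L / 40))"
        using \<eta>_ge[OF that(3)] by (intro mult_left_mono) auto
      also have "\<dots> \<le> (L ^ 3 * card B) * exp (- (3 * L / 40))"
        using small[OF that(1,2)] by (intro mult_right_mono) auto
      also have "\<dots> \<le> (exp (3 * L / 40) * card B) * exp (- (3 * L / 40))"
        using L(2) by (intro mult_right_mono) auto
      also have "\<dots> = card B" by (simp add: exp_minus field_simps)
      finally show ?thesis .
    qed
    define big where "big = (\<lambda>j. \<exists>W\<subseteq>V. \<alpha> W \<le> j \<and> card V * exp (- \<eta> j) \<le> card W)"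
    have "big (\<alpha> A)" using small'[OF A(1,2) \<alpha>A] A(1) unfolding big_def by blast
    define j where "j = (LEAST j. big j)"
    have "big j" unfolding j_def using \<open>big (\<alpha> A)\<close> by (rule LeastI)
    then obtain W where W: "W \<subseteq> V" "\<alpha> W \<le> j" "card V * exp (- \<eta> j) \<le> card W"
      unfolding big_def by blast
    have "j \<le> \<alpha> A" unfolding j_def using \<open>big (\<alpha> A)\<close> by (rule Least_le)
    then have jL: "real j \<le> L / 4" using \<alpha>A by linarith
    have least: "card B < card V * exp (- \<eta> i)" if "B \<subseteq> V" "\<alpha> B \<le> i" "i < j" for B i
      using not_less_Least[of i big] that unfolding j_def big_def by force
    have "0 < card V * exp (- \<eta> j)" using card_V_pos by simp
    then have "W \<noteq> {}" using W(3) by auto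
    then have j1: "1 \<le> j" using \<alpha>_pos[OF W(1)] W(2) by linarith
    define t where "t = (j + 3) div 4"
    have t: "j \<le> 4 * t" "0 < t" "t \<le> j" using j1 by (auto simp: t_def)
    define q where "q = exp (- (\<eta> (j - 1) - \<eta> j))"
    show ?thesis
    proof (rule that[of W t q])
      show "exp (9 / 10 * L) \<le> card W"
      proof -
        have "\<eta> j \<le> L / 10" using L(1) by (simp add: \<eta>_def)
        then have "exp (9 / 10 * L) \<le> exp (L + - \<eta> j)" by simp
        also have "\<dots> = card V * exp (- \<eta> j)" by (simp only: exp_add n)
        finally show ?thesis using W(3) by linarith
      qed
      show "t \<le> \<alpha> B" if "B \<subseteq> V" "card V \<le> 4 * \<alpha> V * card B" for B
      proof (rule ccontr)
        assume "\<not> t \<le> \<alpha> B"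
        then have "\<alpha> B < j" using t by linarith
        moreover have "real (\<alpha> B) \<le> L / 4" using \<open>\<alpha> B < j\<close> jL by linarith
        ultimately show False using least[OF that(1) order_refl] small'[OF that] by fastforce
      qed
      show "t \<le> \<alpha> U" if U: "U \<subseteq> W" "card W \<le> 2 * card U" for U
      proof (rule ccontr)
        assume "\<not> t \<le> \<alpha> U"
        then have i: "4 * \<alpha> U \<le> j" "\<alpha> U < j" using t by (auto simp: t_def)
        have "sqrt (L * \<alpha> U) \<le> sqrt (L * j / 4)"
          using i(1) L(1) by (intro real_sqrt_le_mono) (simp add: field_simps)
        also have "\<dots> = sqrt (L * j) / 2" by (simp add: real_sqrt_divide)
        finally have s: "sqrt (L * \<alpha> U) \<le> sqrt (L * j) / 2" .
        have "sqrt (40 ^ 2) \<le> sqrt (L * j)"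
          using L(1) j1 by (intro real_sqrt_le_mono) (auto intro: order_trans[OF _ mult_mono[of 1600 L 1 "real j"]])
        then have "40 \<le> sqrt (L * j)" by simp
        moreover have "\<eta> (\<alpha> U) - \<eta> j = (sqrt (L * j) - sqrt (L * \<alpha> U)) / 20"
          by (simp add: \<eta>_def diff_divide_distrib)
        ultimately have "ln 2 \<le> \<eta> (\<alpha> U) - \<eta> j" using s ln_2_less_1 by argo
        then have "card V * exp (- \<eta> (\<alpha> U)) \<le> card V * exp (- ln 2 + - \<eta> j)"
          by (intro mult_left_mono) auto
        also have "\<dots> = card V * exp (- \<eta> j) / 2" unfolding exp_add by (simp add: exp_minus)
        also have "\<dots> \<le> card W / 2" using W(3) by simp
        finally have "real (card U) < card W / 2"
          using least[of U "\<alpha> U"] U(1) W(1) i(2) by force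
        then show False using U(2) by linarith
      qed
      show "real (card (non_nbrs W v)) \<le> q * card W" if "v \<in> W" for v
      proof -
        have "\<alpha> {v} + \<alpha> (non_nbrs W v) \<le> \<alpha> ({v} \<union> non_nbrs W v)"
          using W(1) that by (intro \<alpha>_additive) (auto simp: non_nbrs_def nbhd_def)
        also have "\<dots> \<le> \<alpha> W" using W(1) that by (intro \<alpha>_mono) (auto simp: non_nbrs_def)
        finally have "\<alpha> (non_nbrs W v) \<le> j - 1" using \<alpha>_pos[of "{v}"] W(1,2) that by auto
        then have "card (non_nbrs W v) < card V * exp (- \<eta> (j - 1))"
          using W(1) j1 by (intro least) (auto simp: non_nbrs_def)
        also have "\<dots> = q * (card V * exp (- \<eta> j))" by (simp add: q_def exp_diff exp_minus field_simps)
        also have "\<dots> \<le> q * card W" using W(3) by (intro mult_left_mono) (auto simp: q_def)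
        finally show ?thesis by simp
      qed
      show "q * L ^ 2 \<le> 3 * 10 ^ 9 * real t ^ 2"
      proof -
        define y where "y = sqrt (L / j)"
        have y: "0 \<le> y" "y ^ 2 = L / j" using L(1) by (auto simp: y_def)
        have "y / 40 \<le> \<eta> (j - 1) - \<eta> j"
        proof -
          have "(sqrt (L * j) - sqrt (L * (real j - 1))) * (sqrt (L * j) + sqrt (L * (real j - 1))) = L"
            using L(1) j1 by (simp add: algebra_simps flip: power2_eq_square)
          moreover have "sqrt (L * (real j - 1)) \<le> sqrt (L * j)"
            using L(1) by (intro real_sqrt_le_mono) auto
          ultimately have "L \<le> (sqrt (L * j) - sqrt (L * (real j - 1))) * (2 * sqrt (L * j))"
            by (metis add_left_mono diff_ge_0_iff_ge mult_2 mult_left_mono)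
          then have "L / sqrt (L * j) \<le> 2 * (sqrt (L * j) - sqrt (L * (real j - 1)))"
            using L(1) j1 by (simp add: field_simps)
          moreover have "L / sqrt (L * j) = (L / sqrt L) / sqrt j" by (simp add: real_sqrt_mult)
          then have "L / sqrt (L * j) = y"
            using L(1) by (simp add: y_def real_div_sqrt real_sqrt_divide)
          moreover have "\<eta> (j - 1) - \<eta> j = (sqrt (L * j) - sqrt (L * (real j - 1))) / 20"
            using j1 by (simp add: \<eta>_def of_nat_diff diff_divide_distrib)
          ultimately show ?thesis by linarith
        qed
        then have "q \<le> exp (- y / 40)" by (simp add: q_def)
        then have "y ^ 4 * q \<le> 64 * 40 ^ 4"
          using fourth_power_times_exp_le[OF y(1)] by (meson mult_left_mono order_trans zero_le_power y(1))
        moreover have "real j ^ 2 \<le> (4 * real t) ^ 2" using t(1) by (intro power_mono) auto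
        ultimately have "(y ^ 4 * q) * real j ^ 2 \<le> (64 * 40 ^ 4) * (4 * real t) ^ 2"
          by (rule mult_mono) auto
        moreover have "y ^ 4 * real j ^ 2 = L ^ 2"
        proof -
          have "y ^ 4 = (y ^ 2) ^ 2" by simp
          then show ?thesis using j1 by (simp add: y(2) power_divide)
        qed
        ultimately have "q * L ^ 2 \<le> 2621440000 * real t ^ 2"
          by (simp add: power_mult_distrib ac_simps)
        also have "\<dots> \<le> 3 * 10 ^ 9 * real t ^ 2" by (intro mult_right_mono) auto
        finally show ?thesis .
      qed
    qed (use W(1) t jL L(1) in \<open>auto simp: q_def\<close>)
  qed
qed

end


section \<open>Large linked sets in extremal graphs\<close>

lemma cube_le_exp:
  assumes "1600 \<le> (L :: real)"
  shows "L ^ 3 \<le> exp (3 * L / 40)"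
proof -
  define u where "u = L / 1600"
  have u: "1 \<le> u" using assms by (simp add: u_def)
  have "1 + u \<le> exp u" by (rule exp_ge_add_one_self)
  then have e: "2 \<le> exp u" "u \<le> exp u" using u by linarith+
  have "L ^ 3 = 1600 ^ 3 * u ^ 3" by (simp add: u_def power_divide)
  also have "\<dots> \<le> 2 ^ 117 * u ^ 3" using u by (intro mult_right_mono) auto
  also have "\<dots> \<le> exp u ^ 117 * exp u ^ 3"
    using u e by (intro mult_mono power_mono) auto
  also have "\<dots> = exp (3 * L / 40)"
    by (simp flip: exp_of_nat_mult exp_add) (simp add: u_def)
  finally show ?thesis .
qed

context extremal_graph begin

text \<open>
  The blocks of \<open>sparse_block_family\<close> are taken in the set \<open>W\<close> of \<open>dense_part\<close>, their number \<open>b\<close> being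
  chosen such that half of their union has at least \<open>p = sqrt n L / (10\<^sup>7 \<alpha> V)\<close> elements.  What has to be
  checked is the budget of \<open>routing_to_most_of_block_union\<close>.  The pairs between different blocks number
  at most \<open>16 q p\<^sup>2\<close> and are joined by paths of length at most \<open>8 \<alpha> V / t\<close>; by \<open>q L\<^sup>2 \<le> 3 * 10\<^sup>9 t\<^sup>2\<close>
  they fit (\<open>part1\<close>), and the constant \<open>10\<^sup>7\<close> is chosen for this.  The pairs inside the blocks contribute
  only lower-order terms (\<open>part2\<close>), for which \<open>L \<ge> 1600\<close> leaves ample room.

  The hypothesis \<open>\<alpha> V \<le> sqrt n L\<close> costs nothing, because otherwise the claimed size is below \<open>1\<close>.
\<close>

lemma large_linked_set:
  defines "L \<equiv> ln (real (card V))"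
  assumes L: "1600 \<le> L" and \<alpha>V: "\<alpha> V \<le> sqrt (card V) * L"
  obtains P Q \<rho> l where "P \<subseteq> V" "Q \<subseteq> P" "routing P l (missing Q) \<rho>"
    "sqrt (card V) * L \<le> 10 ^ 7 * real (\<alpha> V) * real (card Q)"
proof -
  define n where "n = real (card V)"
  define a where "a = real (\<alpha> V)"
  have n: "exp L = n" "0 < n" using card_V_pos by (simp_all add: L_def n_def)
  have a: "0 < a" using \<alpha>V_pos by (simp add: a_def)
  have sqrt_n: "sqrt n = exp (L / 2)"
    using n by (metis exp_half_le2 real_sqrt_unique exp_ge_zero field_sum_of_halves mult_exp_exp power2_eq_square)
  have L3: "L ^ 3 \<le> exp (3 * L / 40)" using cube_le_exp[OF L] .
  obtain W t and q :: real where W: "W \<subseteq> V" "exp (9 / 10 * L) \<le> card W" "0 < t" "real t \<le> L" "0 < q"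
    "q * L ^ 2 \<le> 3 * 10 ^ 9 * real t ^ 2"
    "\<And>A. A \<subseteq> V \<Longrightarrow> card V \<le> 4 * \<alpha> V * card A \<Longrightarrow> t \<le> \<alpha> A"
    "\<And>U. U \<subseteq> W \<Longrightarrow> card W \<le> 2 * card U \<Longrightarrow> t \<le> \<alpha> U"
    "\<And>v. v \<in> W \<Longrightarrow> real (card (non_nbrs W v)) \<le> q * card W"
    using dense_part[folded L_def, OF L L3] by blast
  define T where "T = real t"
  have T: "1 \<le> T" "T \<le> L" using W(3,4) by (auto simp: T_def)
  have "t \<le> \<alpha> V" using W(7)[of V] \<alpha>V_pos by simp
  then have Ta: "T \<le> a" by (simp add: T_def a_def)
  define p where "p = sqrt n * L / (10 ^ 7 * a)"
  have p: "0 < p" using L n a by (simp add: p_def)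
  have ap: "a * p = sqrt n * L / 10 ^ 7" using a by (simp add: p_def)
  have "a ^ 2 * p ^ 2 = (sqrt n * L / 10 ^ 7) ^ 2" by (simp only: ap power_mult_distrib[symmetric])
  also have "\<dots> = n * L ^ 2 / 10 ^ 14" using n by (simp add: power_mult_distrib power_divide)
  finally have ap2: "a ^ 2 * p ^ 2 = n * L ^ 2 / 10 ^ 14" .
  define b where "b = nat \<lceil>2 * p / T\<rceil>"
  have "0 < 2 * p / T" using p T by simp
  then have b: "2 * p / T \<le> b" "b \<le> 2 * p / T + 1" unfolding b_def by linarith+
  have bT: "2 * p \<le> b * T" "b * T \<le> 2 * p + T" using b T by (simp_all add: field_simps)
  have size_W: "4 * b * t \<le> card W"
  proof -
    have "p \<le> sqrt n * L"
    proof -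
      have "1 \<le> a" using \<alpha>V_pos by (simp add: a_def)
      then have "1 \<le> 10 ^ 7 * a" by simp
      moreover have "0 < sqrt n * L" using n L by simp
      ultimately have "sqrt n * L / (10 ^ 7 * a) \<le> sqrt n * L / 1" by (intro divide_left_mono) auto
      then show ?thesis by (simp add: p_def)
    qed
    moreover have "L \<le> sqrt n * L" using n L sqrt_n by simp
    ultimately have "4 * (b * T) \<le> 12 * (sqrt n * L)" using bT T by linarith
    also have "\<dots> = 12 * L * exp (L / 2)" by (simp add: sqrt_n)
    also have "\<dots> \<le> L ^ 3 * exp (L / 2)"
    proof (intro mult_right_mono)
      have "1600 ^ 2 \<le> L ^ 2" using L by (intro power_mono) auto
      then have "12 * L \<le> L ^ 2 * L" using L by (intro mult_right_mono) auto
      then show "12 * L \<le> L ^ 3" by (simp add: power2_eq_square power3_eq_cube)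
    qed simp
    also have "\<dots> \<le> exp (3 * L / 40) * exp (L / 2)" using L3 by (intro mult_right_mono) auto
    also have "\<dots> \<le> exp (9 / 10 * L)" using L by (simp flip: exp_add)
    also note W(2)
    finally have "real (4 * b * t) \<le> card W" by (simp add: T_def)
    then show ?thesis by (simp only: of_nat_le_iff)
  qed
  obtain \<B> where \<B>: "finite \<B>" "card \<B> = b" "pairwise disjnt \<B>"
    "\<forall>B\<in>\<B>. B \<subseteq> W \<and> indep B \<and> card B = t"
    and miss: "real (card (missing (\<Union>\<B>))) \<le>
      real b * real t ^ 2 + 2 * q * real b * (real b - 1) * real t ^ 2"
    using sparse_block_family[OF W(1,3,8,5,9) size_W] by blast
  define P where "P = \<Union>\<B>"
  have PV: "P \<subseteq> V" using \<B>(4) W(1) by (auto simp: P_def)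
  have "card P = (\<Sum>B\<in>\<B>. card B)"
    unfolding P_def using \<B>(3,4) W(1) finite_subset_V by (intro card_Union_disjoint) (auto intro: finite_subset)
  then have cardP: "real (card P) = b * T" using \<B>(2,4) by (simp add: T_def)
  \<comment> \<open>Two bounds on the number of search rounds: \<open>r1\<close> is proportional to \<open>a / T\<close>, which matters for
    the pairs between different blocks; \<open>r2\<close> is proportional to \<open>L\<close>, which matters for the pairs inside
    a block when \<open>a\<close> is close to \<open>sqrt n\<close>.\<close>
  define r1 where "r1 = nat \<lceil>2 * (a / T)\<rceil>"
  define r2 where "r2 = nat \<lceil>5 * L\<rceil>"
  define r where "r = min r1 r2"
  have aT: "1 \<le> a / T" using Ta T by simp
  have r1: "2 * (a / T) \<le> r1" "r1 \<le> 2 * (a / T) + 1" using aT unfolding r1_def by linarith+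
  have r2: "5 * L \<le> r2" "r2 \<le> 5 * L + 1" using L unfolding r2_def by linarith+
  have "a < 2 * ((5 / 4) ^ r1 * T)"
  proof -
    have "a + 2 * T = 2 * ((1 + 2 * (a / T) / 4) * T)" using T by (simp add: field_simps)
    also have "\<dots> \<le> 2 * ((1 + real r1 * (1 / 4)) * T)"
      using r1(1) T by (intro mult_left_mono mult_right_mono) auto
    also have "\<dots> \<le> 2 * ((1 + 1 / 4) ^ r1 * T)"
      using T by (intro mult_left_mono mult_right_mono Bernoulli_inequality) auto
    finally show ?thesis using T by simp
  qed
  moreover have "a < 2 * ((5 / 4) ^ r2 * T)"
  proof -
    have "a \<le> n" using \<alpha>_le_card[of V] by (simp add: a_def n_def)
    also have "n \<le> exp (real r2 * (1 / 5))" using r2(1) by (simp flip: n(1))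
    also have "\<dots> = exp (1 / 5) ^ r2" by (rule exp_of_nat_mult)
    also have "\<dots> \<le> (5 / 4) ^ r2"
    proof (intro power_mono)
      have "4 / 5 \<le> exp (- (1 / 5) :: real)" using exp_ge_add_one_self[of "- (1 / 5)"] by simp
      then show "exp (1 / 5 :: real) \<le> 5 / 4" by (simp add: exp_minus field_simps)
    qed simp
    also have "\<dots> \<le> (5 / 4) ^ r2 * T" using T by simp
    finally have "a \<le> (5 / 4) ^ r2 * T" .
    then show ?thesis using a by linarith
  qed
  ultimately have r: "\<alpha> V < 2 * ((5 / 4) ^ r * real t)"
    unfolding r_def min_def a_def T_def by simp
  define l where "l = real (2 * r + 2)"
  have "l \<le> 2 * r1 + 2" "l \<le> 2 * r2 + 2" by (auto simp: l_def r_def)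
  then have l: "l \<le> 8 * (a / T)" "l \<le> 11 * L" using r1 r2 aT L by linarith+
  have bb: "real b * (real b - 1) * T ^ 2 \<le> 8 * p ^ 2"
  proof (cases "b \<le> 1")
    case True
    then have "b = 0 \<or> b = 1" by auto
    then show ?thesis by auto
  next
    case False
    then have "2 \<le> real b" by simp
    then have "1 \<le> 2 * p / T" using b(2) by linarith
    then have "real b * T \<le> 4 * p" "(real b - 1) * T \<le> 2 * p"
      using b(2) T by (simp_all add: field_simps)
    then have "(real b * T) * ((real b - 1) * T) \<le> (4 * p) * (2 * p)"
      using T p False by (intro mult_mono[of "real b * T"]) auto
    then show ?thesis by (simp add: power2_eq_square ac_simps)
  qed
  have "real (card (missing P)) \<le> b * T ^ 2 + 2 * q * (b * (real b - 1) * T ^ 2)"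
    using miss unfolding P_def T_def by (simp only: mult.assoc)
  then have "card (missing P) * l \<le> (b * T ^ 2 + 2 * q * (b * (real b - 1) * T ^ 2)) * l"
    by (intro mult_right_mono) (auto simp: l_def)
  also have "\<dots> \<le> (b * T ^ 2 + 2 * q * (8 * p ^ 2)) * l"
    using bb W(5) by (intro mult_right_mono add_left_mono mult_left_mono) (auto simp: l_def)
  also have "\<dots> = b * T ^ 2 * l + 16 * q * p ^ 2 * l" by (simp add: algebra_simps)
  also have "\<dots> \<le> b * T ^ 2 * (11 * L) + 16 * q * p ^ 2 * (8 * (a / T))"
    using l W(5) by (intro add_mono mult_left_mono) auto
  finally have ml: "card (missing P) * l \<le> b * T * (11 * L * T) + 128 * q * p ^ 2 * a / T"
    by (simp add: power2_eq_square ac_simps)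
  have part1: "4 * a * (128 * q * p ^ 2 * a / T) \<le> T * n / 2"
  proof -
    have "4 * a * (128 * q * p ^ 2 * a / T) = 512 * q * (a ^ 2 * p ^ 2) / T"
      by (simp add: power2_eq_square ac_simps)
    also have "\<dots> = 512 / 10 ^ 14 * n * (q * L ^ 2) / T" by (simp add: ap2)
    also have "\<dots> \<le> 512 / 10 ^ 14 * n * (3 * 10 ^ 9 * T ^ 2) / T"
      using W(6) n T by (intro divide_right_mono mult_left_mono) (auto simp: T_def)
    also have "\<dots> \<le> T * n / 2" using T n by (simp add: power2_eq_square)
    finally show ?thesis .
  qed
  have part2: "4 * a * (b * T * (1 + 11 * L * T)) \<le> T * n / 2"
  proof -
    have "1 \<le> L * T" using L T by (metis mult_mono one_le_numeral order_trans mult_1 zero_le_one)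
    then have "4 * a * (b * T * (1 + 11 * L * T)) \<le> 4 * a * ((2 * p + T) * (12 * L * T))"
      using bT(2) a p T L by (intro mult_left_mono mult_mono) auto
    also have "\<dots> = T * (96 * L * (a * p) + 48 * L * T * a)" by (simp add: algebra_simps)
    also have "\<dots> \<le> T * (n / 2)"
    proof (intro mult_left_mono)
      have "48 * L * T * a \<le> 48 * L * L * (sqrt n * L)"
        using T L a \<alpha>V by (intro mult_mono) (auto simp: a_def n_def)
      moreover have "96 * L * (a * p) \<le> L * L * (sqrt n * L)"
        unfolding ap using L n by (simp add: field_simps)
      ultimately have "96 * L * (a * p) + 48 * L * T * a \<le> 49 * (L ^ 3 * sqrt n)"
        by (simp add: power3_eq_cube algebra_simps)
      also have "\<dots> \<le> L ^ 3 / 2 * (L ^ 3 * sqrt n)"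
      proof (intro mult_right_mono)
        have "1600 ^ 3 \<le> L ^ 3" using L by (intro power_mono) auto
        then show "49 \<le> L ^ 3 / 2" by simp
      qed (use L n in auto)
      also have "\<dots> = L ^ 3 * L ^ 3 * exp (L / 2) / 2" by (simp add: sqrt_n)
      also have "\<dots> \<le> exp (3 * L / 40) * exp (3 * L / 40) * exp (L / 2) / 2"
        using L3 L by (intro divide_right_mono mult_right_mono mult_mono) auto
      also have "\<dots> \<le> n / 2" using L by (simp flip: exp_add n(1))
      finally show "96 * L * (a * p) + 48 * L * T * a \<le> n / 2" .
    qed (use T in auto)
    finally show ?thesis by simp
  qed
  have "4 * a * (card P + card (missing P) * l) \<le>
      4 * a * (b * T + (b * T * (11 * L * T) + 128 * q * p ^ 2 * a / T))"
    using ml cardP a by (intro mult_left_mono add_mono) auto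
  also have "\<dots> = 4 * a * (b * T * (1 + 11 * L * T)) + 4 * a * (128 * q * p ^ 2 * a / T)"
    by (simp add: algebra_simps)
  also have "\<dots> \<le> T * n" using part1 part2 by simp
  finally have "real (4 * \<alpha> V * (card P + card (missing P) * (2 * r + 2))) \<le> real (t * card V)"
    by (simp add: a_def T_def n_def l_def algebra_simps)
  then have budget: "4 * \<alpha> V * (card P + card (missing P) * (2 * r + 2)) \<le> t * card V"
    by (simp only: of_nat_le_iff)
  have blocks: "B \<subseteq> V \<and> indep B \<and> card B = t" if "B \<in> \<B>" for B
    using \<B>(4) W(1) that by blast
  obtain Q \<rho> where Q: "Q \<subseteq> P" "card P \<le> 2 * card Q" "routing P (2 * r + 2) (missing Q) \<rho>"
    using routing_to_most_of_block_union[OF \<B>(1,3) blocks W(3) P_def W(7) r budget] .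
  have "real (card P) \<le> 2 * card Q" using Q(2) by linarith
  then have "p \<le> card Q" using cardP bT(1) by linarith
  then have "sqrt (card V) * L \<le> 10 ^ 7 * real (\<alpha> V) * real (card Q)"
    using a by (simp add: p_def a_def n_def field_simps)
  then show ?thesis using that[OF PV Q(1,3)] by blast
qed

end


section \<open>Chromatic number and subdivision number\<close>

text \<open>
  For a minimiser \<open>U\<close> of \<open>f(A) = \<alpha>(A)\<^sup>3 / |A|\<^sup>2\<close>, the cube root of the minimum is the constant \<open>\<kappa>\<close> of the greedy
  colouring, and \<open>U\<close> induces an extremal graph.  If \<open>ln |U| < 1600\<close>, then \<open>\<kappa>\<close> is bounded below by a constant, and
  \<open>n powr (1/3)\<close> is of smaller order than \<open>sqrt n / ln n\<close>.  Otherwise \<open>key\<close> bounds \<open>1 / \<alpha>(U)\<close>, hence \<open>1 / \<kappa>\<close>, in terms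
  of \<open>\<sigma>\<close>, either by \<open>large_linked_set\<close> or, if \<open>\<alpha>(U) > sqrt |U| ln |U|\<close>, by \<open>\<sigma> \<ge> 1\<close>.
\<close>

lemma chromatic_number_le_subdivision_number:
  fixes G :: "('a :: linorder) pair_pre_digraph"
  assumes G: "pair_graph G" and n: "2 \<le> card (pverts G)"
  shows "chromatic_number G \<le>
    (18 * exp 1600 + 3 * 10 ^ 7) * (sqrt (card (pverts G)) / ln (card (pverts G))) * subdivision_number G"
proof -
  interpret G: pair_graph G by fact
  define V where "V = pverts G"
  define E where "E = (\<lambda>x y. (x, y) \<in> parcs G)"
  interpret finite_graph V E
    using G.pair_finite_verts G.arcs_symmetric G.no_loops' by unfold_locales (auto simp: V_def E_def)
  define \<sigma> where "\<sigma> = real (subdivision_number G)"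
  define f where "f = (\<lambda>A. real (\<alpha> A) ^ 3 / real (card A) ^ 2)"
  have V: "V \<noteq> {}" using n by (auto simp: V_def)
  have \<sigma>1: "1 \<le> \<sigma>" using subdivision_number_pos[OF G] V by (simp add: \<sigma>_def V_def)
  define U where "U = arg_min_on f {A. A \<subseteq> V \<and> A \<noteq> {}}"
  have fin: "finite {A. A \<subseteq> V \<and> A \<noteq> {}}" and ne: "{A. A \<subseteq> V \<and> A \<noteq> {}} \<noteq> {}"
    using finite_V V by auto
  have U: "U \<subseteq> V" "U \<noteq> {}"
    using arg_min_if_finite(1)[OF fin ne, of f] by (simp_all add: U_def)
  have least: "f U \<le> f A" if "A \<subseteq> V" "A \<noteq> {}" for A
    using arg_min_if_finite(2)[OF fin ne, of f] that by (auto simp: U_def not_less)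
  have U_pos: "0 < card U" "1 \<le> \<alpha> U" using U \<alpha>_pos finite_subset_V by (auto simp: card_gt_0_iff)
  have card_pos: "0 < card A" if "A \<subseteq> V" "A \<noteq> {}" for A
    using that finite_subset_V by (simp add: card_gt_0_iff)
  interpret U: extremal_graph U E
  proof unfold_locales
    show "finite U" using U finite_subset_V by blast
    show "\<alpha> U ^ 3 * card A ^ 2 \<le> \<alpha> A ^ 3 * card U ^ 2" if "A \<subseteq> U" for A
    proof (cases "A = {}")
      case False
      then have "f U \<le> f A" "0 < card A" using that U(1) least card_pos by auto
      then have "real (\<alpha> U) ^ 3 * real (card A) ^ 2 \<le> real (\<alpha> A) ^ 3 * real (card U) ^ 2"
        using U_pos by (simp add: f_def field_simps)
      then show ?thesis by (simp only: of_nat_le_iff flip: of_nat_power of_nat_mult)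
    qed simp
  qed (use U sym irrefl in auto)
  define x where "x = ln (real (card U))"
  define y where "y = ln (real (card V))"
  have x: "exp x = card U" "0 \<le> x" using U_pos by (auto simp: x_def)
  have y: "exp y = card V" "0 < y" using n by (auto simp: y_def V_def)
  have xy: "x \<le> y"
    using card_mono[OF finite_V U(1)] U_pos(1) unfolding x_def y_def by simp
  define \<kappa> where "\<kappa> = real (\<alpha> U) * exp (- (2 * x / 3))"
  have \<kappa>: "0 < \<kappa>" using U_pos by (simp add: \<kappa>_def)
  have "\<kappa> ^ 3 = real (\<alpha> U) ^ 3 * exp (- (2 * x))"
    by (simp add: \<kappa>_def power_mult_distrib flip: exp_of_nat_mult)
  also have "exp (- (2 * x)) = 1 / real (card U) ^ 2"
    by (simp add: exp_minus exp_double x(1) inverse_eq_divide)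
  finally have \<kappa>3: "\<kappa> ^ 3 = f U" by (simp add: f_def)
  have large: "\<kappa> * root 3 (card A) ^ 2 \<le> \<alpha> A" if "A \<subseteq> V" for A
  proof (cases "A = {}")
    case False
    define w where "w = root 3 (card A)"
    have w: "w ^ 3 = card A" by (simp add: w_def)
    have "(\<kappa> * w ^ 2) ^ 3 = \<kappa> ^ 3 * (w ^ 3) ^ 2"
      by (simp add: power_mult_distrib)
    also have "\<dots> \<le> f A * real (card A) ^ 2"
      using least[OF that False] by (auto simp: \<kappa>3 w intro: mult_right_mono)
    also have "\<dots> = real (\<alpha> A) ^ 3" using card_pos[OF that False] by (simp add: f_def)
    finally show ?thesis
      using power_mono_iff[of "\<kappa> * w ^ 2" "real (\<alpha> A)" 3] \<kappa> by (simp add: w_def)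
  qed simp
  obtain c k where c: "\<forall>v\<in>V. c v < k" "\<forall>u\<in>V. \<forall>v\<in>V. E u v \<longrightarrow> c u \<noteq> c v"
    and k: "real k \<le> 3 * root 3 (card V) / \<kappa>"
    using greedy_colouring[OF \<kappa> large order_refl] by blast
  have "colourable G k"
    unfolding colourable_def using c by (intro exI[of _ c])
      (auto simp: V_def E_def dest: G.in_arcsD1 G.in_arcsD2)
  then have "chromatic_number G \<le> k" unfolding chromatic_number_def by (rule Least_le)
  moreover have "root 3 (card V) = exp (y / 3)"
    by (rule real_root_pos_unique) (auto simp: y(1) simp flip: exp_of_nat_mult)
  ultimately have \<chi>: "chromatic_number G \<le> 3 * exp (y / 3) / \<kappa>" using k by simp
  have half: "sqrt (card V) = exp (y / 2)" "sqrt (card U) = exp (x / 2)"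
    by (rule real_sqrt_unique; simp add: x(1) y(1) flip: exp_of_nat_mult)+
  have "3 * exp (y / 3) / \<kappa> \<le> (18 * exp 1600 + 3 * 10 ^ 7) * (exp (y / 2) / y) * \<sigma>"
  proof (cases "x < 1600")
    case True
    have exp_bound: "y \<le> 6 * exp (y / 6)"
      using exp_ge_add_one_self[of "y / 6"] by linarith
    have "exp (- 1600) \<le> 1 * exp (- (2 * x / 3))" using True x(2) by simp
    also have "\<dots> \<le> \<kappa>" unfolding \<kappa>_def using U_pos by (intro mult_right_mono) auto
    finally have "3 * exp (y / 3) / \<kappa> \<le> 3 * exp (y / 3) / exp (- 1600)"
      using \<kappa> by (intro divide_left_mono) auto
    also have "\<dots> = 3 * exp 1600 * (y * exp (y / 3)) / y" using y(2) by (simp add: exp_minus field_simps)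
    also have "\<dots> \<le> 3 * exp 1600 * (6 * exp (y / 6) * exp (y / 3)) / y"
      using exp_bound y(2) by (intro divide_right_mono mult_left_mono mult_right_mono) auto
    also have "\<dots> = 18 * exp 1600 * (exp (y / 2) / y) * 1"
      by (simp flip: exp_add)
    also have "\<dots> \<le> (18 * exp 1600 + 3 * 10 ^ 7) * (exp (y / 2) / y) * \<sigma>"
      using \<sigma>1 y(2) by (intro mult_mono) auto
    finally show ?thesis .
  next
    case False
    then have x_large: "1600 \<le> x" by simp
    have key: "exp (x / 2) * x \<le> 10 ^ 7 * real (\<alpha> U) * \<sigma>"
    proof (cases "\<alpha> U \<le> sqrt (card U) * x")
      case True
      obtain P Q \<rho> l where P: "P \<subseteq> U" "Q \<subseteq> P" "U.routing P l (U.missing Q) \<rho>"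
        and Q: "sqrt (card U) * x \<le> 10 ^ 7 * real (\<alpha> U) * real (card Q)"
        using U.large_linked_set[folded x_def, OF x_large True] .
      have "contains_complete_subdivision G (card Q)"
      proof (rule contains_complete_subdivision_if_links[OF G])
        show "Q \<subseteq> pverts G" using P U(1) by (auto simp: V_def)
        show "links (\<lambda>x y. (x, y) \<in> parcs G) u (\<rho> (u, v)) v \<and> set (\<rho> (u, v)) \<subseteq> pverts G - Q"
          if "(u, v) \<in> U.missing Q" for u v
          using P that U(1) unfolding U.routing_def E_def[symmetric] V_def[symmetric] by fastforce
        show "set (\<rho> e) \<inter> set (\<rho> f) = {}" if "e \<in> U.missing Q" "f \<in> U.missing Q" "e \<noteq> f" for e f
          using P(3) that unfolding U.routing_def by blast
        show "U.missing Q = {(x, y). x \<in> Q \<and> y \<in> Q \<and> x < y \<and> (x, y) \<notin> parcs G}"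
          unfolding U.missing_def by (simp only: E_def)
      qed
      then have "card Q \<le> subdivision_number G"
        unfolding subdivision_number_def
        by (intro Max_ge finite_contains_complete_subdivision[OF G]) simp
      then have "10 ^ 7 * real (\<alpha> U) * real (card Q) \<le> 10 ^ 7 * real (\<alpha> U) * \<sigma>"
        by (intro mult_left_mono) (auto simp: \<sigma>_def)
      then show ?thesis using Q half by simp
    next
      case False
      then have "exp (x / 2) * x \<le> 1 * real (\<alpha> U) * 1" using half by simp
      also have "\<dots> \<le> 10 ^ 7 * real (\<alpha> U) * \<sigma>" using \<sigma>1 by (intro mult_mono) auto
      finally show ?thesis .
    qed
    \<comment> \<open>The function \<open>exp (x / 6) / x\<close> is increasing for \<open>x \<ge> 6\<close>.\<close>
    have "y * exp (x / 6) \<le> x * (1 + (y - x) / 6) * exp (x / 6)"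
    proof (intro mult_right_mono)
      have "6 * (y - x) \<le> x * (y - x)" using x_large xy by (intro mult_right_mono) auto
      then show "y \<le> x * (1 + (y - x) / 6)" by (simp add: field_simps)
    qed simp
    also have "\<dots> \<le> x * exp ((y - x) / 6) * exp (x / 6)"
      using x(2) by (intro mult_right_mono mult_left_mono exp_ge_add_one_self) auto
    also have "\<dots> = x * exp (y / 6)" by (simp add: diff_divide_distrib flip: exp_add)
    finally have mono: "y * exp (x / 6) \<le> x * exp (y / 6)" .
    have x0: "0 < x" using x_large by simp
    have "3 * exp (y / 3) / \<kappa> = 3 * exp (y / 3) * exp (2 * x / 3) / \<alpha> U"
      by (simp add: \<kappa>_def exp_minus field_simps)
    also have "\<dots> = 3 * exp (y / 3) * exp (x / 6) * (exp (x / 2) * x) / (real (\<alpha> U) * x)"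
      using x0 by (simp flip: exp_add)
    also have "\<dots> \<le> 3 * exp (y / 3) * exp (x / 6) * (10 ^ 7 * real (\<alpha> U) * \<sigma>) / (real (\<alpha> U) * x)"
      using key x0 by (intro divide_right_mono mult_left_mono) auto
    also have "\<dots> = 3 * 10 ^ 7 * exp (y / 3) * (y * exp (x / 6)) / (x * y) * \<sigma>"
      using x0 y(2) U_pos by (simp add: field_simps)
    also have "\<dots> \<le> 3 * 10 ^ 7 * exp (y / 3) * (x * exp (y / 6)) / (x * y) * \<sigma>"
      using mono x0 y(2) \<sigma>1 by (intro mult_right_mono divide_right_mono mult_left_mono) auto
    also have "\<dots> = 3 * 10 ^ 7 * (exp (y / 2) / y) * \<sigma>"
      using x0 by (simp flip: exp_add)
    also have "\<dots> \<le> (18 * exp 1600 + 3 * 10 ^ 7) * (exp (y / 2) / y) * \<sigma>"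
      using \<sigma>1 y(2) by (intro mult_right_mono) auto
    finally show ?thesis .
  qed
  then show ?thesis using \<chi> half by (simp add: \<sigma>_def y_def V_def)
qed

theorem theorem1p1:
  shows "\<exists>C :: real. \<forall>n :: nat. n \<ge> 2 \<longrightarrow> hajos_H n \<le> C * real n powr (1 / 2) / ln (real n)"
proof (intro exI allI impI)
  fix n :: nat assume n: "2 \<le> n"
  define C :: real where "C = 18 * exp 1600 + 3 * 10 ^ 7"
  have "r \<le> C * real n powr (1 / 2) / ln (real n)" if r: "r \<in> chi_sigma_ratios n" for r
  proof -
    obtain G :: "nat pair_pre_digraph" where G: "pair_graph G" "card (pverts G) = n"
      "r = real (chromatic_number G) / real (subdivision_number G)"
      using r unfolding chi_sigma_ratios_def by blast
    have "pverts G \<noteq> {}" using G(2) n by auto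
    then have "0 < real (subdivision_number G)" using subdivision_number_pos[OF G(1)] by simp
    then show ?thesis
      using chromatic_number_le_subdivision_number[OF G(1)] G(2,3) n
      by (simp add: pos_divide_le_eq powr_half_sqrt C_def)
  qed
  then show "hajos_H n \<le> (18 * exp 1600 + 3 * 10 ^ 7) * real n powr (1 / 2) / ln (real n)"
    unfolding hajos_H_def C_def
    using finite_chi_sigma_ratios chi_sigma_ratios_nonempty by (intro Max.boundedI) auto
qed

end
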